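(* Let $a\in\mathbb{C}\setminus\{0,-1,-2,\ldots\}$. For $\operatorname{Re}(s)>1$ we have $$\zeta_H(s,a)=\Gamma(1-s)\,I(s,a)+\zeta_H(s),$$ where $$I(s,a)=\frac{1}{2\pi i}\int_C\frac{z^{s-1}}{1-e^z}\left\{e^{za}\,\Phi(e^z,1;a)+\log(1-e^z)\right\}dz$$ and $C$ is the Hankel contour.
   Context: For $a\in\mathbb{C}\setminus\{0,-1,-2,\ldots\}$ and integer $n\ge0$, $H_n(a)=\sum_{k=0}^{n}\frac{1}{k+a}$, and for $\operatorname{Re}(s)>1$, $\zeta_H(s,a)=\sum_{n=0}^{\infty}\frac{H_n(a)}{(n+a)^s}$ and $\zeta_H(s)=\zeta_H(s,1)=\sum_{n=1}^\infty \frac{H_n}{n^s}$ with $H_n=\sum_{k=1}^n \frac1k$. $\Gamma$ is the Euler gamma function; at integers $s\ge 2$, where $\Gamma(1-s)$ has a pole, the product $\Gamma(1-s)I(s,a)$ is understood as its limit. The Lerch transcendent is $\Phi(x,s;a)=\sum_{k=0}^{\infty}\frac{x^k}{(k+a)^s}$ for $|x|<1$, extended by analytic continuation. The Hankel contour $C=C_-\cup C_+\cup C_\varepsilon$ starts at $-\infty$, runs along the lower side of the negative real axis ($C_-$: $z=xe^{-\pi i}$), encircles the origin once counter-clockwise along a circle of small radius $\varepsilon$ ($C_\varepsilon$: $z=\varepsilon e^{i\theta}$), and returns to $-\infty$ along the upper side of the negative real axis ($C_+$: $z=xe^{\pi i}$); $z^{s-1}$ is taken with $\arg z\in[-\pi,\pi]$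 accordingly. On $C_\varepsilon$ the bracket is understood via the expansion $e^{za}\Phi(e^z,1;a)=\sum_{n=1}^\infty\frac{\zeta(1-n,a)}{n!}z^n+\psi(1)-\psi(a)-\log(-z)$, where $\zeta(s,a)$ is the Hurwitz zeta function and $\psi=\Gamma'/\Gamma$, so that the bracket equals $\sum_{n=1}^\infty\frac{\zeta(1-n,a)}{n!}z^n+\psi(1)-\psi(a)+\log\frac{e^z-1}{z}$ near $z=0$ (with the branch of the last logarithm vanishing at $z=0$).
   Formalization: For Re a ≤ 0 the integral I(s,a) diverges along the rays, so there it is read as the analytic continuation in a from Re a > 0 to the plane cut along (−∞,0], with the limit from above on the cut; for Re a > 0 it is the literal contour integral. *)

theory Defs
  imports "HOL-Complex_Analysis.Complex_Analysis"
begin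

text \<open>
  All complex powers \<^term>\<open>z powr s\<close> with base \<open>k + a\<close> use the principal branch
  (argument in \<open>(-\<pi>, \<pi>]\<close>).
\<close>

definition shifted_harm :: "nat \<Rightarrow> complex \<Rightarrow> complex" where
  "shifted_harm n a = (\<Sum>k\<le>n. 1 / (of_nat k + a))"

definition harm_zeta :: "complex \<Rightarrow> complex \<Rightarrow> complex" where
  "harm_zeta s a = (\<Sum>n. shifted_harm n a / (of_nat n + a) powr s)"

definition lerch_series :: "complex \<Rightarrow> complex \<Rightarrow> complex \<Rightarrow> complex" where
  "lerch_series x s a = (\<Sum>k. x ^ k / (of_nat k + a) powr s)"

text \<open>The continuation is the principal one, to the plane cut along \<open>[1, \<infinity>)\<close>.\<close>

definition lerch_phi :: "complex \<Rightarrow> complex \<Rightarrow> complex \<Rightarrow> complex" where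
  "lerch_phi x s a =
     (if norm x < 1 then lerch_series x s a
      else (THE w. \<exists>f. f holomorphic_on (- (of_real ` {1..})) \<and>
                       (\<forall>y. norm y < 1 \<longrightarrow> f y = lerch_series y s a) \<and> w = f x))"

definition hurwitz_zeta :: "complex \<Rightarrow> complex \<Rightarrow> complex" where
  "hurwitz_zeta s a =
     (THE w. \<exists>f. f holomorphic_on (- {1}) \<and>
                 (\<forall>u. Re u > 1 \<longrightarrow> f u = (\<Sum>n. 1 / (of_nat n + a) powr u)) \<and> w = f s)"

text \<open>The branch of \<open>log ((e\<^sup>z - 1) / z)\<close> on \<open>|z| < 2\<pi>\<close> that vanishes at \<open>z = 0\<close>.\<close>

definition log_expm1_quot :: "complex \<Rightarrow> complex" where
  "log_expm1_quot z =
     (THE w. \<exists>L. L holomorphic_on ball 0 (2 * pi) \<and> L 0 = 0 \<and>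
                 (\<forall>u \<in> ball 0 (2 * pi) - {0}. exp (L u) = (exp u - 1) / u) \<and> w = L z)"

text \<open>
  The bracket \<open>e\<^sup>z\<^sup>a \<Phi>(e\<^sup>z, 1; a) + log (1 - e\<^sup>z)\<close>: literally on the two rays, where
  \<open>0 < e\<^sup>z < 1\<close>, and through its expansion at the origin on the circle, where the
  logarithmic singularities \<open>-log (-z)\<close> and \<open>log (1 - e\<^sup>z)\<close> are combined.
\<close>

definition bracket_ray :: "complex \<Rightarrow> complex \<Rightarrow> complex" where
  "bracket_ray a z = exp (z * a) * lerch_phi (exp z) 1 a + Ln (1 - exp z)"

definition bracket_circle :: "complex \<Rightarrow> complex \<Rightarrow> complex" where
  "bracket_circle a z =
     (\<Sum>n. hurwitz_zeta (1 - of_nat (Suc n)) a / fact (Suc n) * z ^ Suc n)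
     + Digamma 1 - Digamma a + log_expm1_quot z"

text \<open>
  The integrand at \<open>z = r e\<^sup>i\<^sup>\<theta>\<close>, with \<open>z\<^sup>s\<^sup>-\<^sup>1\<close> determined by \<open>arg z = \<theta> \<in> [-\<pi>, \<pi>]\<close>; the
  values \<open>\<theta> = -\<pi>\<close> and \<open>\<theta> = \<pi>\<close> distinguish the two sides of the negative real axis.
\<close>

definition hankel_integrand ::
  "(complex \<Rightarrow> complex) \<Rightarrow> complex \<Rightarrow> real \<Rightarrow> real \<Rightarrow> complex" where
  "hankel_integrand B s r \<theta> =
     exp ((s - 1) * (of_real (ln r) + \<i> * of_real \<theta>)) / (1 - exp (rcis r \<theta>)) * B (rcis r \<theta>)"

text \<open>
  The Hankel contour of radius \<open>\<epsilon>\<close>: in along \<open>z = x e\<^sup>-\<^sup>\<pi>\<^sup>i\<close> (\<open>x\<close> from \<open>\<infinity>\<close> to \<open>\<epsilon>\<close>, hence the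
  minus sign), around \<open>z = \<epsilon> e\<^sup>i\<^sup>\<theta>\<close>, and out along \<open>z = x e\<^sup>\<pi>\<^sup>i\<close>.  The factors \<^term>\<open>cis (- pi)\<close>,
  \<open>\<i> \<epsilon> e\<^sup>i\<^sup>\<theta>\<close> and \<^term>\<open>cis pi\<close> are \<open>dz/dx\<close>, \<open>dz/d\<theta>\<close> and \<open>dz/dx\<close>.
\<close>

definition hankel_contour_I :: "real \<Rightarrow> complex \<Rightarrow> complex \<Rightarrow> complex" where
  "hankel_contour_I \<epsilon> s a = 1 / (2 * of_real pi * \<i>) *
     (- integral {\<epsilon>..} (\<lambda>x. hankel_integrand (bracket_ray a) s x (- pi) * cis (- pi))
      + integral {- pi..pi}
          (\<lambda>\<theta>. hankel_integrand (bracket_circle a) s \<epsilon> \<theta> * (\<i> * of_real \<epsilon> * cis \<theta>))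
      + integral {\<epsilon>..} (\<lambda>x. hankel_integrand (bracket_ray a) s x pi * cis pi))"

text \<open>
  On the rays the bracket behaves like \<open>e\<^sup>z\<^sup>a / a\<close> as \<open>z \<rightarrow> -\<infinity>\<close>, so the contour integral
  converges only for \<open>Re a > 0\<close>.  For the remaining \<open>a\<close> it is read as its analytic continuation
  in \<open>a\<close> to the plane cut along \<open>(-\<infinity>, 0]\<close>.  For \<open>a\<close> on the cut the value is the limit
  from above, which matches the principal branch of \<open>(n + a)\<^sup>s\<close>; off the cut the limit
  below is simply \<open>g a\<close>.
\<close>

definition hankel_I :: "real \<Rightarrow> complex \<Rightarrow> complex \<Rightarrow> complex" where
  "hankel_I \<epsilon> s a =
     (if Re a > 0 then hankel_contour_I \<epsilon> s a
      else (THE w. \<exists>g. g holomorphic_on (- \<real>\<^sub>\<le>\<^sub>0) \<and>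
                       (\<forall>b. Re b > 0 \<longrightarrow> g b = hankel_contour_I \<epsilon> s b) \<and>
                       ((\<lambda>t. g (a + \<i> * of_real t)) \<longlongrightarrow> w) (at_right 0)))"

end

theory Submission
  imports Defs "HOL-Real_Asymp.Real_Asymp"
begin

text \<open>
  Summing the Mellin integrals \<open>\<Gamma>(s) / (n + a)\<^sup>s = \<integral> x\<^sup>s\<^sup>-\<^sup>1 e\<^sup>-\<^sup>(\<^sup>n\<^sup>+\<^sup>a\<^sup>)\<^sup>x dx\<close> against \<open>H\<^sub>n(a)\<close> gives, for
  \<open>Re a > 0\<close> and \<open>Re s > 1\<close>, that \<open>\<Gamma>(s) (\<zeta>\<^sub>H(s, a) - \<zeta>\<^sub>H(s))\<close> is the integral over \<open>(0, \<infinity>)\<close> of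
  \<open>x\<^sup>s\<^sup>-\<^sup>1 B(-x) / (1 - e\<^sup>-\<^sup>x)\<close>, where \<open>B\<close> is the bracket on the ray; the logarithm is the case \<open>a = 1\<close> of the
  Lerch term. The bracket has derivative \<open>(e\<^sup>a\<^sup>z - e\<^sup>z) / (1 - e\<^sup>z)\<close> both on the ray and in its expansion
  at the origin, and both versions tend to \<open>\<psi>(1) - \<psi>(a)\<close> at \<open>0\<close>, so they agree. Hence near \<open>0\<close> the
  integrand is \<open>z\<^sup>s\<^sup>-\<^sup>2 K(z)\<close> with \<open>K\<close> holomorphic, and has the primitive \<open>z\<^sup>s\<^sup>-\<^sup>1 P(z)\<close> where
  \<open>(s - 1) P + z P' = K\<close>. The same \<open>P\<close> evaluates the integral over the circle and the integral over
  \<open>(0, \<epsilon>)\<close>, so the Hankel integral is \<open>2i sin(\<pi>s)\<close> times the Mellin integral, and the reflection formula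
  concludes. The remaining \<open>a\<close> follow by uniqueness of analytic continuation, and integer \<open>s\<close> by continuity
  of \<open>\<zeta>\<^sub>H\<close> in \<open>s\<close>.
\<close>

section \<open>Mellin integrals with complex parameters\<close>

text \<open>Cauchy's inequality turns the local majorant \<open>g\<close> of the integrand into the
  majorant \<open>2 * g x / r\<close> of its derivative on the disc of half the radius. That
  majorant bounds all difference quotients, so dominated convergence along sequences differentiates
  under the integral sign.\<close>

lemma holomorphic_on_lebesgue_integral:
  fixes f :: "complex \<Rightarrow> 'a \<Rightarrow> complex"
  assumes "open S"
    and meas: "\<And>z. z \<in> S \<Longrightarrow> f z \<in> borel_measurable M"
    and hol: "\<And>x. x \<in> space M \<Longrightarrow> (\<lambda>z. f z x) holomorphic_on S"
    and dom: "\<And>z0. z0 \<in> S \<Longrightarrow> \<exists>r>0. \<exists>g. cball z0 r \<subseteq> S \<and> integrable M g \<and>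
                (\<forall>z\<in>cball z0 r. \<forall>x\<in>space M. norm (f z x) \<le> g x)"
  shows "(\<lambda>z. integral\<^sup>L M (f z)) holomorphic_on S"
proof -
  have "\<exists>D. ((\<lambda>z. integral\<^sup>L M (f z)) has_field_derivative D) (at z0)" if z0: "z0 \<in> S" for z0
  proof -
    obtain r g where r: "r > 0" "cball z0 r \<subseteq> S" and g: "integrable M g"
      and fg: "\<And>z x. z \<in> cball z0 r \<Longrightarrow> x \<in> space M \<Longrightarrow> norm (f z x) \<le> g x"
      using dom[OF z0] by blast
    have int: "integrable M (f z)" if "z \<in> cball z0 r" for z
      using Bochner_Integration.integrable_bound[OF g meas] fg[OF that] r(2) that by fastforce
    have deriv: "((\<lambda>z. f z x) has_field_derivative deriv (\<lambda>z. f z x) z) (at z)"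
      if "z \<in> S" "x \<in> space M" for z x
      using hol[OF that(2)] \<open>open S\<close> that(1) by (rule holomorphic_derivI)
    have dbound: "norm (deriv (\<lambda>z. f z x) z) \<le> 2 * g x / r"
      if z: "z \<in> cball z0 (r/2)" and x: "x \<in> space M" for z x
    proof -
      have sub: "cball z (r/2) \<subseteq> cball z0 r"
      proof
        fix y assume y: "y \<in> cball z (r/2)"
        have "dist z0 y \<le> dist z0 z + dist z y" by (rule dist_triangle)
        with z y show "y \<in> cball z0 r" by simp
      qed
      have hol': "(\<lambda>z. f z x) holomorphic_on cball z (r/2)"
        using hol[OF x] sub r(2) by (meson holomorphic_on_subset order_trans)
      \<comment> \<open>The disc of radius \<open>r/2\<close> about \<open>z\<close> still lies in
        \<open>cball z0 r\<close>, where \<open>g x\<close> bounds the integrand.\<close>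
      have "norm ((deriv ^^ 1) (\<lambda>z. f z x) z) \<le> fact 1 * g x / (r/2) ^ 1"
      proof (rule Cauchy_inequality)
        show "(\<lambda>z. f z x) holomorphic_on ball z (r/2)"
          using hol' ball_subset_cball holomorphic_on_subset by blast
        show "continuous_on (cball z (r/2)) (\<lambda>z. f z x)"
          using hol' by (rule holomorphic_on_imp_continuous_on)
        show "norm (f y x) \<le> g x" if "norm (z - y) = r/2" for y
        proof -
          have "y \<in> cball z (r/2)" using that by (simp add: dist_norm)
          then show ?thesis using fg[OF _ x] sub by blast
        qed
      qed (use r in auto)
      then show ?thesis by (simp add: mult.commute)
    qed
    define D where "D = integral\<^sup>L M (\<lambda>x. deriv (\<lambda>z. f z x) z0)"
    have "((\<lambda>z. (integral\<^sup>L M (f z) - integral\<^sup>L M (f z0)) / (z - z0)) \<longlongrightarrow> D) (at z0)"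
      unfolding tendsto_at_iff_sequentially
    proof (intro allI impI)
      fix X assume X: "\<forall>i. X i \<in> UNIV - {z0}" "X \<longlonglongrightarrow> z0"
      have "\<forall>\<^sub>F i in sequentially. X i \<in> ball z0 (r/2)"
        using X(2) r(1) by (intro topological_tendstoD) auto
      then obtain N where N: "\<And>i. i \<ge> N \<Longrightarrow> X i \<in> ball z0 (r/2)"
        by (auto simp: eventually_sequentially)
      \<comment> \<open>Dropping the first \<open>N\<close> terms puts every term into the half
        disc, so that the bound on the quotients holds for all indices and not just
        eventually.\<close>
      define Y where "Y = (\<lambda>i. X (i + N))"
      have Y: "\<And>i. Y i \<in> ball z0 (r/2)" "\<And>i. Y i \<noteq> z0" "Y \<longlonglongrightarrow> z0"
        using N X(1) LIMSEQ_ignore_initial_segment[OF X(2)] by (auto simp: Y_def)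
      have Y': "Y i \<in> cball z0 r" for i using Y(1)[of i] r(1) by simp
      define q where "q = (\<lambda>i x. (f (Y i) x - f z0 x) / (Y i - z0))"
      have lim: "(\<lambda>i. q i x) \<longlonglongrightarrow> deriv (\<lambda>z. f z x) z0" if "x \<in> space M" for x
        using deriv[OF z0 that, unfolded has_field_derivative_iff tendsto_at_iff_sequentially,
            rule_format, of Y] Y by (simp add: q_def o_def)
      have qmeas: "q i \<in> borel_measurable M" for i
      proof -
        have "f (Y i) \<in> borel_measurable M" using Y'[of i] r(2) by (intro meas) blast
        then show ?thesis unfolding q_def using meas[OF z0] by measurable
      qed
      have qbound: "norm (q i x) \<le> 2 * g x / r" if x: "x \<in> space M" for i x
      proof -
        have sub: "cball z0 (r/2) \<subseteq> S" using r subset_cball[of "r/2" r z0] by auto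
        have "norm (f (Y i) x - f z0 x) \<le> (2 * g x / r) * norm (Y i - z0)"
        proof (rule field_differentiable_bound)
          show "convex (cball z0 (r/2))" by (rule convex_cball)
          show "((\<lambda>z. f z x) has_field_derivative deriv (\<lambda>z. f z x) z) (at z within cball z0 (r/2))"
            if "z \<in> cball z0 (r/2)" for z
            using sub that by (intro has_field_derivative_at_within[OF deriv[OF _ x]]) blast
          show "norm (deriv (\<lambda>z. f z x) z) \<le> 2 * g x / r" if "z \<in> cball z0 (r/2)" for z
            using that x by (rule dbound)
          show "Y i \<in> cball z0 (r/2)" using Y(1)[of i] ball_subset_cball by blast
          show "z0 \<in> cball z0 (r/2)" using r(1) by simp
        qed
        moreover have "norm (Y i - z0) > 0" using Y(2)[of i] by simp
        ultimately show ?thesis by (simp only: q_def norm_divide pos_divide_le_eq)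
      qed
      have "(\<lambda>i. integral\<^sup>L M (q i)) \<longlonglongrightarrow> D"
        unfolding D_def
      proof (rule integral_dominated_convergence)
        show "(\<lambda>x. deriv (\<lambda>z. f z x) z0) \<in> borel_measurable M"
          using lim qmeas by (rule borel_measurable_LIMSEQ_metric[rotated])
        show "integrable M (\<lambda>x. 2 * g x / r)" using g by simp
        show "AE x in M. (\<lambda>i. q i x) \<longlonglongrightarrow> deriv (\<lambda>z. f z x) z0" using lim by auto
        show "AE x in M. norm (q i x) \<le> 2 * g x / r" for i using qbound by auto
      qed (rule qmeas)
      moreover have "integral\<^sup>L M (q i) = (integral\<^sup>L M (f (Y i)) - integral\<^sup>L M (f z0)) / (Y i - z0)" for i
        unfolding q_def using int[OF Y'] int[of z0] r(1) by simp
      ultimately have "(\<lambda>i. (integral\<^sup>L M (f (X (i + N))) - integral\<^sup>L M (f z0)) / (X (i + N) - z0)) \<longlonglongrightarrow> D"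
        by (simp add: Y_def)
      from LIMSEQ_offset[OF this]
      show "((\<lambda>z. (integral\<^sup>L M (f z) - integral\<^sup>L M (f z0)) / (z - z0)) \<circ> X) \<longlonglongrightarrow> D"
        by (simp add: o_def)
    qed
    then show ?thesis unfolding has_field_derivative_iff by blast
  qed
  then show ?thesis using \<open>open S\<close> by (simp add: holomorphic_on_open)
qed

section \<open>Gamma integrals with complex exponent and complex scale\<close>

lemma norm_powr_mult_exp:
  assumes "x > 0"
  shows "norm (of_real x powr (s - 1) * exp (- (b * of_real x)) :: complex) =
         x powr (Re s - 1) * exp (- Re b * x)"
  using assms by (simp add: norm_mult norm_powr_real_powr)

text \<open>The norm of the kernel depends only on \<open>Re s\<close> and \<open>Re b\<close>, so
  the kernel with these real parameters dominates it.\<close>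

lemma integrable_Gamma_kernel:
  fixes s b :: complex
  assumes "Re s > 0" "Re b > 0"
  shows "integrable (lebesgue_on {0<..}) (\<lambda>x. of_real x powr (s - 1) * exp (- (b * of_real x)))"
    (is "integrable _ ?f")
proof -
  have 1: "integrable (lebesgue_on {0<..}) (\<lambda>x. complex_of_real x powr (of_real (Re s) - 1) / of_real (exp (Re b * x)))"
    using absolutely_integrable_Gamma_integral[of "of_real (Re s)" "Re b"] assms
    by (simp add: set_integrable_def integrable_restrict_space)
  show ?thesis
  proof (rule Bochner_Integration.integrable_bound[OF 1])
    show "?f \<in> borel_measurable (lebesgue_on {0<..})"
      by (intro continuous_imp_measurable_on_sets_lebesgue continuous_intros) auto
    show "AE x in lebesgue_on {0<..}. norm (?f x) \<le>
        norm (complex_of_real x powr (of_real (Re s) - 1) / of_real (exp (Re b * x)))"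
      using assms by (auto intro!: AE_I2 simp: norm_mult norm_divide norm_powr_real_powr exp_minus field_simps)
  qed
qed

lemma integrable_Gamma_kernel_real:
  fixes p q :: real
  assumes "p > 0" "q > 0"
  shows "integrable (lebesgue_on {0<..}) (\<lambda>x. x powr (p - 1) * exp (- q * x))"
proof -
  have "integrable (lebesgue_on {0<..})
          (\<lambda>x. norm (of_real x powr (of_real p - 1) * exp (- (of_real q * of_real x)) :: complex))"
    using assms by (intro integrable_norm integrable_Gamma_kernel) auto
  also have "?this \<longleftrightarrow> ?thesis"
    by (intro Bochner_Integration.integrable_cong refl) (subst norm_powr_mult_exp, auto)
  finally show ?thesis .
qed

text \<open>The substitution of \<open>b * x\<close> for \<open>x\<close> in Euler's integral; a
  real scale keeps the half line in place.\<close>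

lemma lebesgue_integral_Gamma_kernel_real:
  assumes "Re s > 0" "b > 0"
  shows "integral\<^sup>L (lebesgue_on {0<..}) (\<lambda>x. of_real x powr (s - 1) * exp (- (of_real b * of_real x)))
         = Gamma s / of_real b powr s"
proof -
  define F where "F = (\<lambda>x. complex_of_real x powr (s - 1) * exp (- of_real x))"
  have "F absolutely_integrable_on {0<..}" "integral {0<..} F = Gamma s"
    using absolutely_integrable_Gamma_integral'[OF assms(1)] integral_unique[OF Gamma_integral_complex'[OF assms(1)]]
    by (simp_all add: F_def exp_minus field_simps exp_of_real)
  then have "has_bochner_integral lebesgue (\<lambda>x. indicator {0<..} x *\<^sub>R F x) (Gamma s)"
    using set_lebesgue_integral_eq_integral(2)[of "{0<..}" F]
    by (simp add: has_bochner_integral_iff set_integrable_def set_lebesgue_integral_def)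
  then have "has_bochner_integral lebesgue (\<lambda>x. indicator {0<..} (0 + b * x) *\<^sub>R F (0 + b * x)) (Gamma s /\<^sub>R \<bar>b\<bar>)"
    using assms(2) by (subst (asm) has_bochner_integral_lebesgue_real_affine_iff[of b _ _ 0]) auto
  also have "(\<lambda>x. indicator {0<..} (0 + b * x) *\<^sub>R F (0 + b * x)) =
     (\<lambda>x. of_real b powr (s - 1) * (indicator {0<..} x *\<^sub>R (of_real x powr (s - 1) * exp (- (of_real b * of_real x)))))"
    using assms(2) by (auto simp: fun_eq_iff indicator_def F_def zero_less_mult_iff powr_times_real)
  finally have "has_bochner_integral lebesgue
      (\<lambda>x. 1 / of_real b powr (s - 1) * (of_real b powr (s - 1) *
         (indicator {0<..} x *\<^sub>R (of_real x powr (s - 1) * exp (- (of_real b * of_real x))))))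
      (1 / of_real b powr (s - 1) * (Gamma s /\<^sub>R \<bar>b\<bar>))"
    by (intro has_bochner_integral_mult_right)
  then have "has_bochner_integral lebesgue (\<lambda>x. indicator {0<..} x *\<^sub>R (of_real x powr (s - 1) * exp (- (of_real b * of_real x))))
      (Gamma s / of_real b powr (s - 1) /\<^sub>R b)"
    using assms(2) by (simp add: mult.assoc [symmetric])
  moreover have "Gamma s / of_real b powr (s - 1) /\<^sub>R b = Gamma s / of_real b powr s"
    using assms(2) by (simp add: powr_diff scaleR_conv_of_real field_simps)
  ultimately show ?thesis by (simp add: integral_restrict_space has_bochner_integral_iff)
qed

text \<open>Both sides are holomorphic in \<open>b\<close> on the right half plane and agree for
  positive real \<open>b\<close>, so the identity theorem replaces a rotation of the path of
  integration.\<close>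

lemma lebesgue_integral_Gamma_kernel:
  assumes "Re s > 0" "Re b > 0"
  shows "integral\<^sup>L (lebesgue_on {0<..}) (\<lambda>x. of_real x powr (s - 1) * exp (- (b * of_real x)))
         = Gamma s / b powr s"
proof -
  define f where "f = (\<lambda>b x. complex_of_real x powr (s - 1) * exp (- (b * of_real x)))"
  define S where "S = {b. Re b > 0}"
  have S: "open S" "connected S"
    by (auto simp: S_def open_halfspace_Re_gt convex_connected convex_halfspace_Re_gt)
  have 1: "(\<lambda>b. integral\<^sup>L (lebesgue_on {0<..}) (f b)) holomorphic_on S"
  proof (rule holomorphic_on_lebesgue_integral)
    show "f z \<in> borel_measurable (lebesgue_on {0<..})" if "z \<in> S" for z
      using integrable_Gamma_kernel[OF assms(1), of z] that
      by (auto simp: f_def S_def)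
    show "(\<lambda>z. f z x) holomorphic_on S" for x
      unfolding f_def by (intro holomorphic_intros)
    show "\<exists>r>0. \<exists>g. cball z0 r \<subseteq> S \<and> integrable (lebesgue_on {0<..}) g \<and>
                (\<forall>z\<in>cball z0 r. \<forall>x\<in>space (lebesgue_on {0<..}). norm (f z x) \<le> g x)" if z0: "z0 \<in> S" for z0
    proof (intro exI conjI ballI)
      \<comment> \<open>With this radius every \<open>z\<close> in the disc has
        \<open>Re z \<ge> r\<close>, so the kernel with scale \<open>r\<close> is a common
        majorant.\<close>
      define r where "r = Re z0 / 2"
      show "r > 0" using z0 by (simp add: r_def S_def)
      have Re: "Re z \<ge> r" if "z \<in> cball z0 r" for z
        using that complex_Re_le_cmod[of "z0 - z"] by (simp add: r_def dist_norm)
      then show "cball z0 r \<subseteq> S" using \<open>r > 0\<close> by (force simp: S_def)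
      show "integrable (lebesgue_on {0<..}) (\<lambda>x. x powr (Re s - 1) * exp (- r * x))"
        using assms(1) \<open>r > 0\<close> by (rule integrable_Gamma_kernel_real)
      show "norm (f z x) \<le> x powr (Re s - 1) * exp (- r * x)"
        if "z \<in> cball z0 r" "x \<in> space (lebesgue_on {0<..})" for z x
        using Re[OF that(1)] that(2) unfolding f_def
        by (subst norm_powr_mult_exp) (auto intro!: mult_left_mono)
    qed
  qed (rule S)
  have "integral\<^sup>L (lebesgue_on {0<..}) (f b) - Gamma s / b powr s = 0"
  proof (rule analytic_continuation[where f = "\<lambda>b. integral\<^sup>L (lebesgue_on {0<..}) (f b) - Gamma s / b powr s"])
    show "(\<lambda>b. integral\<^sup>L (lebesgue_on {0<..}) (f b) - Gamma s / b powr s) holomorphic_on S"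
      using 1 by (intro holomorphic_intros) (auto simp: S_def complex_nonpos_Reals_iff)
    show "complex_of_real ` {0<..} \<subseteq> S" by (auto simp: S_def)
    show "1 \<in> S" "b \<in> S" using assms by (auto simp: S_def)
    \<comment> \<open>These positive reals differ from 1 and tend to 1, so the positive axis
      accumulates at a point of \<open>S\<close>.\<close>
    have "(\<lambda>n. complex_of_real (1 + inverse (real (Suc n)))) \<longlonglongrightarrow> of_real (1 + 0)"
      by (intro tendsto_intros LIMSEQ_inverse_real_of_nat)
    moreover have "complex_of_real (1 + inverse (real (Suc n))) \<in> of_real ` {0<..} - {1}" for n
    proof -
      have "1 + inverse (real (Suc n)) > 0" "1 + inverse (real (Suc n)) \<noteq> 1"
        by (simp_all add: add_pos_pos)
      then show ?thesis by (metis DiffI greaterThan_iff imageI of_real_eq_1_iff singletonD)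
    qed
    ultimately show "1 islimpt (of_real ` {0<..} :: complex set)"
      unfolding islimpt_sequential by (intro exI[of _ "\<lambda>n. of_real (1 + inverse (real (Suc n)))"]) simp_all
    show "integral\<^sup>L (lebesgue_on {0<..}) (f z) - Gamma s / z powr s = 0" if "z \<in> complex_of_real ` {0<..}" for z
      using that lebesgue_integral_Gamma_kernel_real[OF assms(1)] by (auto simp: f_def)
  qed (use S in auto)
  then show ?thesis by (simp add: f_def)
qed

text \<open>
  The power series solution \<open>P\<close> of \<open>c P + z P' = F\<close>; equivalently, \<open>z\<^sup>c P\<close> is a primitive of \<open>z\<^sup>c\<^sup>-\<^sup>1 F\<close>.
\<close>

definition euler_fps :: "complex \<Rightarrow> complex fps \<Rightarrow> complex fps" where
  "euler_fps c F = Abs_fps (\<lambda>n. fps_nth F n / (c + of_nat n))"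

text \<open>Once \<open>n \<ge> norm c + 1\<close>, the denominator \<open>c + n\<close> has norm at
  least 1, so the new coefficients are eventually no larger than those of \<open>F\<close>.\<close>

lemma fps_conv_radius_euler_fps:
  "fps_conv_radius (euler_fps c F) \<ge> fps_conv_radius F"
  unfolding fps_conv_radius_def
proof (rule conv_radius_geI_ex')
  fix r :: real assume r: "0 < r" "ereal r < conv_radius (fps_nth F)"
  have "summable (\<lambda>n. norm (fps_nth F n * of_real r ^ n))"
    using r by (intro abs_summable_in_conv_radius) simp
  then show "summable (\<lambda>n. fps_nth (euler_fps c F) n * of_real r ^ n)"
  proof (rule summable_comparison_test_ev[rotated])
    show "\<forall>\<^sub>F n in sequentially. norm (fps_nth (euler_fps c F) n * of_real r ^ n)
            \<le> norm (fps_nth F n * of_real r ^ n)"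
      using eventually_ge_at_top[of "nat \<lceil>norm c + 1\<rceil>"]
    proof eventually_elim
      case (elim n)
      then have "1 \<le> norm (of_nat n :: complex) - norm c" by simp linarith
      also have "\<dots> \<le> norm (c + of_nat n)" by (metis add.commute norm_diff_ineq)
      finally have "1 \<le> norm (c + of_nat n)" .
      then have "norm (fps_nth F n * of_real r ^ n) / norm (c + of_nat n) \<le> norm (fps_nth F n * of_real r ^ n) / 1"
        by (intro divide_left_mono) auto
      then show ?case by (simp add: euler_fps_def norm_mult norm_divide)
    qed
  qed
qed

lemma euler_fps_ode:
  assumes "\<And>n. c + of_nat n \<noteq> 0"
  shows "fps_const c * euler_fps c F + fps_X * fps_deriv (euler_fps c F) = F"
proof (rule fps_ext)
  fix n
  show "fps_nth (fps_const c * euler_fps c F + fps_X * fps_deriv (euler_fps c F)) n = fps_nth F n"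
  proof -
    have "fps_nth (fps_const c * euler_fps c F + fps_X * fps_deriv (euler_fps c F)) n
            = (c + of_nat n) * fps_nth (euler_fps c F) n"
      by (cases n) (auto simp: algebra_simps)
    then show ?thesis using assms[of n] by (simp add: euler_fps_def)
  qed
qed

lemma eval_euler_fps_ode:
  assumes "\<And>n. c + of_nat n \<noteq> 0" "norm z < fps_conv_radius F"
  shows "c * eval_fps (euler_fps c F) z + z * eval_fps (fps_deriv (euler_fps c F)) z = eval_fps F z"
proof -
  let ?P = "euler_fps c F"
  have 1: "norm z < fps_conv_radius ?P"
    using assms(2) fps_conv_radius_euler_fps by (rule order.strict_trans2)
  then have 2: "norm z < fps_conv_radius (fps_deriv ?P)"
    using fps_conv_radius_deriv by (rule order.strict_trans2)
  have 3: "norm z < fps_conv_radius (fps_const c * ?P)" "norm z < fps_conv_radius (fps_X * fps_deriv ?P)"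
    using 1 2 by (auto intro!: order.strict_trans2[OF _ fps_conv_radius_mult])
  have "eval_fps F z = eval_fps (fps_const c * ?P + fps_X * fps_deriv ?P) z"
    by (simp add: euler_fps_ode[OF assms(1)])
  also have "\<dots> = c * eval_fps ?P z + z * eval_fps (fps_deriv ?P) z"
    using 1 2 3 by (subst eval_fps_add) (simp_all add: eval_fps_mult)
  finally show ?thesis by simp
qed

lemma has_field_derivative_euler_fps:
  assumes "norm z < fps_conv_radius F"
  shows "(eval_fps (euler_fps c F) has_field_derivative eval_fps (fps_deriv (euler_fps c F)) z) (at z within A)"
  using order.strict_trans2[OF assms fps_conv_radius_euler_fps] by (rule has_field_derivative_eval_fps)

text \<open>By the equation for \<open>euler_fps\<close>, evaluated at \<open>-t\<close>, the
  integrand has the primitive \<open>t powr c * P (-t)\<close>. It is continuous up to 0 and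
  vanishes there because \<open>Re c > 0\<close>, while differentiability is only available in the
  interior.\<close>

lemma has_integral_mellin_fps:
  assumes c: "Re c > 0" and x: "0 < x" "ereal x < fps_conv_radius F"
  shows "((\<lambda>t. of_real t powr (c - 1) * eval_fps F (- of_real t)) has_integral
           of_real x powr c * eval_fps (euler_fps c F) (- of_real x)) {0..x}"
proof -
  let ?P = "euler_fps c F"
  have c': "c + of_nat n \<noteq> 0" for n
    using c by (auto simp: complex_eq_iff add_nonneg_eq_0_iff)
  have rad: "ereal (norm (- complex_of_real t)) < fps_conv_radius F" if "t \<in> {0..x}" for t
    using that x by (cases "fps_conv_radius F") auto
  have "((\<lambda>t. of_real t powr (c - 1) * eval_fps F (- of_real t)) has_integral
           (of_real x powr c * eval_fps ?P (- of_real x) - of_real 0 powr c * eval_fps ?P (- of_real 0))) {0..x}"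
  proof (rule fundamental_theorem_of_calculus_interior)
    have "continuous_on {0..x} (\<lambda>t. complex_of_real t powr c)"
      using c by (intro continuous_intros) auto
    moreover have "continuous_on {0..x} (\<lambda>t. eval_fps ?P (- of_real t))"
      using order.strict_trans2[OF rad fps_conv_radius_euler_fps]
      by (intro continuous_intros) auto
    ultimately show "continuous_on {0..x} (\<lambda>t. of_real t powr c * eval_fps ?P (- of_real t))"
      by (rule continuous_on_mult)
    show "((\<lambda>t. of_real t powr c * eval_fps ?P (- of_real t)) has_vector_derivative
            of_real t powr (c - 1) * eval_fps F (- of_real t)) (at t)" if t: "t \<in> {0<..<x}" for t
    proof -
      have r: "ereal (norm (- complex_of_real t)) < fps_conv_radius F" using t by (intro rad) auto
      have P: "((\<lambda>z. eval_fps ?P (- z)) has_field_derivative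
              - eval_fps (fps_deriv ?P) (- of_real t)) (at (of_real t))"
        by (rule DERIV_chain2[where f = "eval_fps ?P" and g = uminus, THEN DERIV_cong,
              OF has_field_derivative_euler_fps[OF r]]) (auto intro!: derivative_eq_intros)
      have "((\<lambda>z. z powr c * eval_fps ?P (- z)) has_field_derivative
              c * of_real t powr (c - 1) * eval_fps ?P (- of_real t) +
              - eval_fps (fps_deriv ?P) (- of_real t) * of_real t powr c) (at (of_real t))"
        using t by (intro DERIV_mult P has_field_derivative_powr) (auto simp: complex_nonpos_Reals_iff)
      also have "c * of_real t powr (c - 1) * eval_fps ?P (- of_real t) +
              - eval_fps (fps_deriv ?P) (- of_real t) * of_real t powr c =
              of_real t powr (c - 1) * (c * eval_fps ?P (- of_real t) + (- of_real t) * eval_fps (fps_deriv ?P) (- of_real t))"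
        using t by (simp add: powr_diff algebra_simps)
      also have "\<dots> = of_real t powr (c - 1) * eval_fps F (- of_real t)"
        by (subst eval_euler_fps_ode[OF c' r]) simp
      finally show ?thesis
        using has_vector_derivative_real_field by blast
    qed
  qed (use x in auto)
  then show ?thesis by simp
qed

text \<open>Integration term by term. The integral of the norm of the n-th term is
  \<open>norm (c n) * Gamma (Re s) * (n + Re a) powr (- Re s)\<close>, which is summable by
  hypothesis.\<close>

lemma mellin_dirichlet_series:
  fixes c :: "nat \<Rightarrow> complex"
  assumes s: "Re s > 0" and a: "Re a > 0"
    and summ: "summable (\<lambda>n. norm (c n) * (of_nat n + Re a) powr (- Re s))"
  shows "integrable (lebesgue_on {0<..})
           (\<lambda>x. of_real x powr (s - 1) * (\<Sum>n. c n * exp (- ((of_nat n + a) * of_real x))))"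
    and "integral\<^sup>L (lebesgue_on {0<..})
           (\<lambda>x. of_real x powr (s - 1) * (\<Sum>n. c n * exp (- ((of_nat n + a) * of_real x))))
         = Gamma s * (\<Sum>n. c n / (of_nat n + a) powr s)"
    and "\<And>x. x > 0 \<Longrightarrow> summable (\<lambda>n. norm (c n * exp (- ((of_nat n + a) * of_real x))))"
proof -
  define f where "f = (\<lambda>n x. c n * (complex_of_real x powr (s - 1) * exp (- ((of_nat n + a) * of_real x))))"
  let ?M = "lebesgue_on {0::real<..}"
  show 1: "summable (\<lambda>n. norm (c n * exp (- ((of_nat n + a) * of_real x))))" if "x > 0" for x
  proof (rule summable_comparison_test_ev[OF _ summ])
    \<comment> \<open>Exponential decay beats the power, so the summability hypothesis also gives
      absolute convergence of the series at each \<open>x > 0\<close>.\<close>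
    have "(\<lambda>n. (real n + Re a) powr (Re s) * exp (- ((real n + Re a) * x))) \<longlonglongrightarrow> 0"
      using that s a by real_asymp
    then have "\<forall>\<^sub>F n in sequentially. (real n + Re a) powr (Re s) * exp (- ((real n + Re a) * x)) < 1"
      by (rule order_tendstoD) auto
    then show "\<forall>\<^sub>F n in sequentially. norm (norm (c n * exp (- ((of_nat n + a) * of_real x))))
        \<le> norm (c n) * (of_nat n + Re a) powr (- Re s)"
    proof eventually_elim
      case (elim n)
      have "exp (- ((real n + Re a) * x)) \<le> (real n + Re a) powr (- Re s)"
        using elim a by (simp add: powr_minus field_simps)
      then show ?case by (simp add: norm_mult mult_left_mono)
    qed
  qed
  have eq: "of_real x powr (s - 1) * (\<Sum>n. c n * exp (- ((of_nat n + a) * of_real x))) = (\<Sum>n. f n x)"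
    if "x > 0" for x
    using 1[OF that, THEN summable_norm_cancel] unfolding f_def by (subst suminf_mult [symmetric]) (auto simp: mult_ac)
  have int: "integrable ?M (f n)" for n
    unfolding f_def using s a by (intro integrable_mult_right integrable_Gamma_kernel) auto
  have norms: "AE x in ?M. summable (\<lambda>n. norm (f n x))"
  proof (rule AE_I2)
    fix x assume "x \<in> space ?M"
    then have "x > 0" by simp
    from summable_mult[OF 1[OF this], of "norm (of_real x powr (s - 1) :: complex)"]
    show "summable (\<lambda>n. norm (f n x))" unfolding f_def by (simp add: norm_mult mult_ac)
  qed
  have "integral\<^sup>L ?M (\<lambda>x. norm (f n x)) = norm (c n) * (Gamma (Re s) * (real n + Re a) powr (- Re s))" for n
  proof -
    have "of_real (integral\<^sup>L ?M (\<lambda>x. norm (f n x))) =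
       integral\<^sup>L ?M (\<lambda>x. complex_of_real (norm (f n x)))" by simp
    also have "\<dots> = integral\<^sup>L ?M (\<lambda>x. of_real (norm (c n)) *
        (of_real x powr (of_real (Re s) - 1) * exp (- (of_real (real n + Re a) * of_real x))))"
    proof (intro Bochner_Integration.integral_cong refl)
      fix x assume "x \<in> space ?M"
      moreover have "exp (- (complex_of_real (real n + Re a) * of_real x)) = of_real (exp (- Re (of_nat n + a) * x))"
        by (subst exp_of_real [symmetric]) (rule arg_cong[where f = exp], simp add: algebra_simps)
      ultimately show "complex_of_real (norm (f n x)) = of_real (norm (c n)) *
        (of_real x powr (of_real (Re s) - 1) * exp (- (of_real (real n + Re a) * of_real x)))"
        unfolding f_def norm_mult[of "c n"]
        by (subst norm_powr_mult_exp) (simp_all add: powr_of_real [symmetric] del: of_real_add)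
    qed
    also have "\<dots> = of_real (norm (c n)) * (Gamma (of_real (Re s)) / of_real (real n + Re a) powr of_real (Re s))"
      using s a by (subst integral_mult_right_zero, subst lebesgue_integral_Gamma_kernel_real) auto
    also have "\<dots> = of_real (norm (c n) * (Gamma (Re s) * (real n + Re a) powr (- Re s)))"
      using a powr_of_real[of "real n + Re a" "Re s"] by (simp add: Gamma_complex_of_real powr_minus divide_inverse)
    finally show ?thesis by (simp only: of_real_eq_iff)
  qed
  then have sums: "summable (\<lambda>n. integral\<^sup>L ?M (\<lambda>x. norm (f n x)))"
    using summable_mult[OF summ, of "Gamma (Re s)"] by (simp add: mult_ac)
  have "integrable ?M (\<lambda>x. \<Sum>n. f n x)"
    by (rule integrable_suminf[OF int norms sums])
  also have "?this \<longleftrightarrow> integrable ?M (\<lambda>x. of_real x powr (s - 1) * (\<Sum>n. c n * exp (- ((of_nat n + a) * of_real x))))"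
    by (intro Bochner_Integration.integrable_cong refl) (simp add: eq)
  finally show "integrable ?M (\<lambda>x. of_real x powr (s - 1) * (\<Sum>n. c n * exp (- ((of_nat n + a) * of_real x))))" .
  have "integral\<^sup>L ?M (\<lambda>x. of_real x powr (s - 1) * (\<Sum>n. c n * exp (- ((of_nat n + a) * of_real x))))
     = integral\<^sup>L ?M (\<lambda>x. \<Sum>n. f n x)"
    by (intro Bochner_Integration.integral_cong refl) (simp add: eq)
  also have int_eq: "(\<lambda>n. integral\<^sup>L ?M (f n)) = (\<lambda>n. Gamma s * (c n / (of_nat n + a) powr s))"
    using s a unfolding f_def by (subst integral_mult_right_zero, subst lebesgue_integral_Gamma_kernel) auto
  have "integral\<^sup>L ?M (\<lambda>x. \<Sum>n. f n x) = (\<Sum>n. integral\<^sup>L ?M (f n))"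
    by (rule integral_suminf[OF int norms sums])
  also have "\<dots> = Gamma s * (\<Sum>n. c n / (of_nat n + a) powr s)"
    unfolding int_eq
  proof (rule suminf_mult)
    \<comment> \<open>Summability of the Dirichlet series is read off from that of the integrals by
      dividing by \<open>Gamma s\<close>, which has no zeros.\<close>
    have "summable (\<lambda>n. 1 / Gamma s * (integral\<^sup>L ?M (f n)))"
      by (intro summable_mult summable_integral[OF int norms sums])
    moreover have "Gamma s \<noteq> 0"
      using s by (auto simp: Gamma_eq_zero_iff nonpos_Ints_def)
    ultimately show "summable (\<lambda>n. c n / (of_nat n + a) powr s)"
      unfolding int_eq fun_cong[OF int_eq] by simp
  qed
  finally show "integral\<^sup>L ?M
           (\<lambda>x. of_real x powr (s - 1) * (\<Sum>n. c n * exp (- ((of_nat n + a) * of_real x))))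
         = Gamma s * (\<Sum>n. c n / (of_nat n + a) powr s)" .
qed

section \<open>Regularity of the harmonic zeta function\<close>

text \<open>The exponent \<open>(1 + c) / 2\<close> lies strictly between 1 and \<open>c\<close>:
  the gap to \<open>c\<close> absorbs the logarithm and the gap to 1 keeps the series
  convergent.\<close>

lemma summable_log_powr:
  assumes "c > 1"
  shows "summable (\<lambda>n. (1 + ln (real n + 1)) * (real n + 1) powr (- c))"
proof (rule summable_comparison_test_bigo)
  have "summable (\<lambda>n. norm (real (Suc n) powr (- ((1 + c) / 2))))"
    using assms by (subst summable_Suc_iff) (simp add: summable_real_powr_iff field_simps)
  then show "summable (\<lambda>n. norm ((real n + 1) powr (- ((1 + c) / 2))))"
    by (simp add: add_ac)
  show "(\<lambda>n. (1 + ln (real n + 1)) * (real n + 1) powr (- c)) \<in> O(\<lambda>n. (real n + 1) powr (- ((1 + c) / 2)))"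
    using assms by real_asymp
qed

lemma of_nat_add_neq_0:
  "a \<notin> \<int>\<^sub>\<le>\<^sub>0 \<Longrightarrow> of_nat n + a \<noteq> (0::complex)"
  using minus_of_nat_in_nonpos_Ints[of n] by (auto simp: add_eq_0_iff)

lemma of_nat_add_notin_nonpos_Reals:
  "a \<notin> \<real>\<^sub>\<le>\<^sub>0 \<Longrightarrow> of_nat n + a \<notin> (\<real>\<^sub>\<le>\<^sub>0 :: complex set)"
  by (auto simp: complex_nonpos_Reals_iff)

text \<open>Linear growth of \<open>norm (n + b)\<close>, uniform for \<open>b\<close> near
  \<open>a\<close>. For \<open>n > N\<close> the triangle inequality gives the factor
  \<open>1/2\<close>; the finitely many other \<open>n\<close> contribute a positive
  minimum.\<close>

lemma nonpos_Ints_lower_bound: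
  fixes a :: complex
  assumes "a \<notin> \<int>\<^sub>\<le>\<^sub>0"
  obtains \<delta> r where "\<delta> > 0" "r > 0"
    "\<And>b n. b \<in> cball a r \<Longrightarrow> \<delta> * (real n + 1) \<le> norm (of_nat n + b)"
proof -
  define N where "N = nat \<lceil>2 * norm a + 1\<rceil>"
  define g where "g = (\<lambda>n. norm (of_nat n + a) / (real n + 1))"
  define \<delta> where "\<delta> = Min (insert (1/2) (g ` {..N}))"
  have pos: "norm (of_nat n + a) > 0" for n
    using of_nat_add_neq_0[OF assms] by simp
  then have "\<delta> > 0" unfolding \<delta>_def g_def by (subst Min_gr_iff) auto
  have le: "\<delta> * (real n + 1) \<le> norm (of_nat n + a)" for n
  proof (cases "n \<le> N")
    case True
    then have "\<delta> \<le> g n" unfolding \<delta>_def by (intro Min_le) auto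
    then show ?thesis by (simp add: g_def field_simps)
  next
    case False
    then have "real n \<ge> 2 * norm a + 1" unfolding N_def by linarith
    then have "(real n + 1) / 2 \<le> norm (of_nat n :: complex) - norm a" by simp
    also have "\<dots> \<le> norm (of_nat n + a)" by (rule norm_diff_ineq)
    finally have "(1/2) * (real n + 1) \<le> norm (of_nat n + a)" by simp
    moreover have "\<delta> \<le> 1/2" unfolding \<delta>_def by (intro Min_le) auto
    ultimately show ?thesis by (meson mult_right_mono order_trans of_nat_0_le_iff add_nonneg_nonneg zero_le_one)
  qed
  \<comment> \<open>Moving from \<open>a\<close> to \<open>b\<close> costs at most
    \<open>\<delta> / 2\<close>, which is at most half of the lower bound at
    \<open>a\<close>.\<close>
  have "\<delta> / 2 * (real n + 1) \<le> norm (of_nat n + b)" if "b \<in> cball a (\<delta> / 2)" for b n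
  proof -
    have "norm (of_nat n + a) \<le> norm (of_nat n + b) + norm (a - b)"
      using norm_triangle_ineq[of "of_nat n + b" "a - b"] by simp
    moreover have "norm (a - b) \<le> \<delta> / 2" using that by (simp add: dist_norm)
    moreover have "\<delta> / 2 \<le> \<delta> / 2 * (real n + 1)" using \<open>\<delta> > 0\<close> by simp
    ultimately show ?thesis using le[of n] by linarith
  qed
  then show ?thesis using that[of "\<delta>/2" "\<delta>/2"] \<open>\<delta> > 0\<close> by auto
qed

lemma norm_shifted_harm_le:
  assumes "\<delta> > 0" "\<And>k. \<delta> * (real k + 1) \<le> norm (of_nat k + b)"
  shows "norm (shifted_harm n b) \<le> (1 + ln (real n + 1)) / \<delta>"
proof -
  have "norm (shifted_harm n b) \<le> (\<Sum>k\<le>n. norm (1 / (of_nat k + b)))"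
    unfolding shifted_harm_def by (rule norm_sum)
  also have "\<dots> \<le> (\<Sum>k\<le>n. inverse (real (Suc k)) / \<delta>)"
  proof (rule sum_mono)
    fix k
    have "1 / norm (of_nat k + b) \<le> 1 / (\<delta> * (real k + 1))"
    proof (rule divide_left_mono[OF assms(2)])
      have "0 < \<delta> * (real k + 1)" using assms(1) by simp
      then show "0 < norm (of_nat k + b) * (\<delta> * (real k + 1))"
        using assms(2)[of k] by (metis mult_pos_pos less_le_trans)
    qed simp
    then show "norm (1 / (of_nat k + b)) \<le> inverse (real (Suc k)) / \<delta>"
      by (simp add: norm_divide field_simps)
  qed
  also have "\<dots> = harm (Suc n) / \<delta>"
    unfolding harm_altdef sum_divide_distrib [symmetric] by (simp add: lessThan_Suc_atMost)
  \<comment> \<open>The sequence \<open>harm m - ln m\<close> decreases from its value 1 at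
    \<open>m = 1\<close>.\<close>
  also have "\<dots> \<le> (1 + ln (real n + 1)) / \<delta>"
    using assms(1) euler_mascheroni_sequence_decreasing[of 1 "Suc n"]
    by (intro divide_right_mono) (auto simp: harm_expand add_ac)
  finally show ?thesis .
qed

text \<open>The norm of \<open>z powr w\<close> is \<open>norm z powr Re w\<close> times
  \<open>exp (- Im w * Im (Ln z))\<close>. The principal argument is at most \<open>pi\<close> in
  absolute value, whence the factor \<open>exp (pi * T)\<close>, and \<open>\<delta> \<le> 1\<close>
  allows replacing the exponent \<open>- Re w\<close> of \<open>\<delta>\<close> by
  \<open>- T\<close>.\<close>

lemma norm_powr_lower_bound:
  assumes "0 < \<delta>" "\<delta> \<le> 1" "\<delta> * (real n + 1) \<le> norm z" "1 < c" "c \<le> Re w" "norm w \<le> T"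
  shows "norm (1 / z powr w) \<le> exp (pi * T) * \<delta> powr (- T) * (real n + 1) powr (- c)"
proof -
  have n: "\<delta> * (real n + 1) > 0" using assms(1) by simp
  have z: "norm z > 0" using n assms(3) by linarith
  then have "z \<noteq> 0" by auto
  have ReT: "Re w \<le> T" and ImT: "\<bar>Im w\<bar> \<le> T"
    using complex_Re_le_cmod[of w] abs_Im_le_cmod[of w] assms(6) by linarith+
  have "norm (1 / z powr w) = exp (- Re (w * Ln z))"
    unfolding powr_minus_divide [symmetric] using \<open>z \<noteq> 0\<close> by (simp add: powr_def)
  also have "- Re (w * Ln z) = - Re w * ln (norm z) + Im w * Im (Ln z)"
    using \<open>z \<noteq> 0\<close> by simp
  also have "exp \<dots> \<le> exp (- Re w * ln (\<delta> * (real n + 1)) + pi * T)"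
  proof (subst exp_le_cancel_iff, rule add_mono)
    have "ln (\<delta> * (real n + 1)) \<le> ln (norm z)" using n z assms(3) by simp
    then show "- Re w * ln (norm z) \<le> - Re w * ln (\<delta> * (real n + 1))"
      using assms(4,5) by (intro mult_left_mono_neg) auto
    have "Im w * Im (Ln z) \<le> \<bar>Im w\<bar> * \<bar>Im (Ln z)\<bar>" by (metis abs_ge_self abs_mult)
    also have "\<dots> \<le> T * pi" using ImT Im_Ln_le_pi[OF \<open>z \<noteq> 0\<close>] mpi_less_Im_Ln[OF \<open>z \<noteq> 0\<close>] by (intro mult_mono) auto
    finally show "Im w * Im (Ln z) \<le> pi * T" by (simp add: mult.commute)
  qed
  also have "\<dots> = exp (pi * T) * \<delta> powr (- Re w) * (real n + 1) powr (- Re w)"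
  proof -
    have l: "ln (\<delta> * (real n + 1)) = ln \<delta> + ln (real n + 1)" using assms(1) by (simp add: ln_mult)
    show ?thesis unfolding l using assms(1) by (simp add: powr_def exp_add [symmetric] algebra_simps)
  qed
  also have "\<dots> \<le> exp (pi * T) * \<delta> powr (- T) * (real n + 1) powr (- c)"
    using assms ReT by (intro mult_mono powr_mono powr_mono') auto
  finally show ?thesis .
qed

text \<open>One Weierstrass majorant for a whole range of parameters and exponents. It serves both
  the continuity and the holomorphy of \<open>harm_zeta\<close>.\<close>

lemma harm_zeta_terms_bound:
  assumes "\<delta> > 0" "1 < c"
  obtains M where "summable M"
    "\<And>n b w. (\<And>k. \<delta> * (real k + 1) \<le> norm (of_nat k + b)) \<Longrightarrow> c \<le> Re w \<Longrightarrow> norm w \<le> T \<Longrightarrow>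
       norm (shifted_harm n b / (of_nat n + b) powr w) \<le> M n"
proof
  define \<delta>' where "\<delta>' = min 1 \<delta>"
  have \<delta>': "0 < \<delta>'" "\<delta>' \<le> 1" "\<delta>' \<le> \<delta>" using assms by (auto simp: \<delta>'_def)
  define M where "M = (\<lambda>n. exp (pi * T) * \<delta>' powr (- T) / \<delta>' * ((1 + ln (real n + 1)) * (real n + 1) powr (- c)))"
  show "summable M" unfolding M_def using assms(2) by (intro summable_mult summable_log_powr)
  show "norm (shifted_harm n b / (of_nat n + b) powr w) \<le> M n"
    if b: "\<And>k. \<delta> * (real k + 1) \<le> norm (of_nat k + b)" and w: "c \<le> Re w" "norm w \<le> T" for n b w
  proof -
    have b': "\<delta>' * (real k + 1) \<le> norm (of_nat k + b)" for k
      using b[of k] mult_right_mono[OF \<delta>'(3), of "real k + 1"] by linarith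
    have "norm (shifted_harm n b * (1 / (of_nat n + b) powr w)) \<le>
       ((1 + ln (real n + 1)) / \<delta>') * (exp (pi * T) * \<delta>' powr (- T) * (real n + 1) powr (- c))"
      unfolding norm_mult
      using norm_shifted_harm_le[OF \<delta>'(1) b'] norm_powr_lower_bound[OF \<delta>'(1,2) b' assms(2) w]
      by (intro mult_mono) (auto intro!: divide_nonneg_pos \<delta>'(1))
    then show ?thesis by (simp add: M_def field_simps)
  qed
qed

text \<open>Tannery's theorem with the uniform majorant. Convergence of the powers is a hypothesis
  because it has two different sources: the approach of \<open>b\<close> to the branch cut from
  above at a fixed exponent, and a varying exponent at a fixed base.\<close>

lemma harm_zeta_tendsto:
  assumes a: "a \<notin> \<int>\<^sub>\<le>\<^sub>0" and s: "Re s > 1" and F: "F \<noteq> bot"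
    and b: "(b \<longlongrightarrow> a) F" and w: "(w \<longlongrightarrow> s) F"
    and powr: "\<And>n. ((\<lambda>x. (of_nat n + b x) powr w x) \<longlongrightarrow> (of_nat n + a) powr s) F"
  shows "((\<lambda>x. harm_zeta (w x) (b x)) \<longlongrightarrow> harm_zeta s a) F"
proof -
  obtain \<delta> r where \<delta>: "\<delta> > 0" "r > 0"
    "\<And>b n. b \<in> cball a r \<Longrightarrow> \<delta> * (real n + 1) \<le> norm (of_nat n + b)"
    using nonpos_Ints_lower_bound[OF a] by metis
  \<comment> \<open>Halfway between 1 and \<open>Re s\<close>, so that
    \<open>c \<le> Re (w x)\<close> eventually while the majorant for \<open>c > 1\<close> still
    applies.\<close>
  define c where "c = (1 + Re s) / 2"
  have c: "c > 1" "c < Re s" using s by (auto simp: c_def field_simps)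
  obtain M where M: "summable M"
    "\<And>n b w. (\<And>k. \<delta> * (real k + 1) \<le> norm (of_nat k + b)) \<Longrightarrow> c \<le> Re w \<Longrightarrow> norm w \<le> norm s + 1 \<Longrightarrow>
       norm (shifted_harm n b / (of_nat n + b) powr w) \<le> M n"
    using harm_zeta_terms_bound[OF \<delta>(1) c(1), where T = "norm s + 1"] by metis
  have nz: "of_nat k + a \<noteq> 0" for k
    using of_nat_add_neq_0[OF a] .
  have "\<forall>\<^sub>F x in F. b x \<in> ball a r" using b \<delta>(2) by (intro topological_tendstoD) auto
  moreover have "\<forall>\<^sub>F x in F. c < Re (w x)"
    using c(2) by (intro order_tendstoD[OF tendsto_Re[OF w]])
  moreover have "\<forall>\<^sub>F x in F. norm (w x) < norm s + 1"
    by (intro order_tendstoD[OF tendsto_norm[OF w]]) auto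
  ultimately have "\<forall>\<^sub>F x in F. \<forall>n. norm (shifted_harm n (b x) / (of_nat n + b x) powr w x) \<le> M n"
  proof eventually_elim
    case (elim x)
    then show ?case using \<delta>(3)[of "b x"] by (intro allI M(2)) auto
  qed
  then have bound: "\<forall>\<^sub>F (n, x) in sequentially \<times>\<^sub>F F. norm (shifted_harm n (b x) / (of_nat n + b x) powr w x) \<le> M n"
    using eventually_prodI[OF always_eventually[of "\<lambda>_. True"]]
    by (fastforce simp: case_prod_unfold elim: eventually_mono)
  have "((\<lambda>x. \<Sum>n. shifted_harm n (b x) / (of_nat n + b x) powr w x) \<longlongrightarrow>
         (\<Sum>n. shifted_harm n a / (of_nat n + a) powr s)) F"
  proof (rule tannerys_theorem[THEN conjunct2, THEN conjunct2, OF _ bound M(1) F])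
    show "((\<lambda>x. shifted_harm n (b x) / (of_nat n + b x) powr w x) \<longlongrightarrow> shifted_harm n a / (of_nat n + a) powr s) F" for n
      unfolding shifted_harm_def using nz by (intro tendsto_intros powr b) auto
  qed
  then show ?thesis by (simp add: harm_zeta_def)
qed

lemma nonpos_Ints_subset_nonpos_Reals: "(\<int>\<^sub>\<le>\<^sub>0 :: complex set) \<subseteq> \<real>\<^sub>\<le>\<^sub>0"
  by (auto elim!: nonpos_Ints_cases simp: complex_nonpos_Reals_iff)

text \<open>Locally uniform convergence of holomorphic terms. Off the cut, each \<open>n + b\<close>
  avoids the jump of the principal power.\<close>

lemma holomorphic_on_harm_zeta:
  assumes "Re s > 1"
  shows "harm_zeta s holomorphic_on (- \<real>\<^sub>\<le>\<^sub>0)"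
proof -
  have "(\<lambda>b. \<Sum>n. shifted_harm n b / (of_nat n + b) powr s) holomorphic_on (- \<real>\<^sub>\<le>\<^sub>0)"
  proof (rule holomorphic_uniform_sequence)
    show "open (- \<real>\<^sub>\<le>\<^sub>0 :: complex set)" by (intro open_Compl closed_nonpos_Reals_complex)
    show "(\<lambda>b. \<Sum>i<n. shifted_harm i b / (of_nat i + b) powr s) holomorphic_on (- \<real>\<^sub>\<le>\<^sub>0)" for n
      unfolding shifted_harm_def
    proof (intro holomorphic_intros)
      show "of_nat k + x \<noteq> 0" if "x \<in> - \<real>\<^sub>\<le>\<^sub>0" for k and x :: complex
        using that nonpos_Ints_subset_nonpos_Reals by (intro of_nat_add_neq_0) blast
      then show "(of_nat k + x) powr s \<noteq> 0" if "x \<in> - \<real>\<^sub>\<le>\<^sub>0" for k x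
        using that by simp
    qed (use of_nat_add_notin_nonpos_Reals in auto)
    show "\<exists>d>0. cball x d \<subseteq> (- \<real>\<^sub>\<le>\<^sub>0) \<and> uniform_limit (cball x d)
       (\<lambda>n b. \<Sum>i<n. shifted_harm i b / (of_nat i + b) powr s)
       (\<lambda>b. \<Sum>n. shifted_harm n b / (of_nat n + b) powr s) sequentially"
      if x: "x \<in> - \<real>\<^sub>\<le>\<^sub>0" for x :: complex
    proof -
      have "x \<notin> \<int>\<^sub>\<le>\<^sub>0" using x nonpos_Ints_subset_nonpos_Reals by blast
      then obtain \<delta> r where \<delta>: "\<delta> > 0" "r > 0"
        "\<And>b n. b \<in> cball x r \<Longrightarrow> \<delta> * (real n + 1) \<le> norm (of_nat n + b)"
        using nonpos_Ints_lower_bound by metis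
      obtain e where e: "e > 0" "cball x e \<subseteq> - \<real>\<^sub>\<le>\<^sub>0"
        using x open_contains_cball[of "- \<real>\<^sub>\<le>\<^sub>0 :: complex set"] by auto
      obtain M where M: "summable M"
        "\<And>n b w. (\<And>k. \<delta> * (real k + 1) \<le> norm (of_nat k + b)) \<Longrightarrow> Re s \<le> Re w \<Longrightarrow> norm w \<le> norm s \<Longrightarrow>
         norm (shifted_harm n b / (of_nat n + b) powr w) \<le> M n"
        using harm_zeta_terms_bound[OF \<delta>(1) assms, where T = "norm s"] by metis
      have "uniform_limit (cball x (min r e))
       (\<lambda>n b. \<Sum>i<n. shifted_harm i b / (of_nat i + b) powr s)
       (\<lambda>b. \<Sum>n. shifted_harm n b / (of_nat n + b) powr s) sequentially"
        using \<delta>(3) by (intro Weierstrass_m_test[OF M(2) M(1)]) auto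
      then show ?thesis using \<delta>(2) e by (intro exI[of _ "min r e"]) auto
    qed
  qed
  then show ?thesis by (simp add: harm_zeta_def [abs_def])
qed

section \<open>The Hurwitz zeta function at non-positive integers\<close>

definition expm1_quot :: "complex \<Rightarrow> complex" where
  "expm1_quot z = (if z = 0 then 1 else (exp z - 1) / z)"

lemma holomorphic_expm1_quot [holomorphic_intros]: "expm1_quot holomorphic_on A"
proof -
  have "((\<lambda>z. (exp z - 1) / z) \<longlongrightarrow> (1::complex)) (at 0)"
    using DERIV_exp[of "0::complex"] unfolding has_field_derivative_iff by simp
  then have "(\<lambda>z. if z = 0 then 1 else (exp z - 1) / z) holomorphic_on (UNIV :: complex set)"
    by (intro removable_singularity holomorphic_intros) auto
  then show ?thesis
    unfolding expm1_quot_def [abs_def] using holomorphic_on_subset by blast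
qed

lemma exp_neq_1_ball:
  assumes "norm (z::complex) < 2 * pi" "z \<noteq> 0"
  shows "exp z \<noteq> 1"
proof
  assume "exp z = 1"
  then obtain n :: int where n: "Re z = 0" "Im z = of_int (2 * n) * pi" by (auto simp: exp_eq_1)
  with assms(2) have "n \<noteq> 0" by (auto simp: complex_eq_iff)
  then have "1 \<le> \<bar>real_of_int n\<bar>" by linarith
  then have "2 * pi * 1 \<le> 2 * pi * \<bar>real_of_int n\<bar>" by (intro mult_left_mono) auto
  also have "\<dots> = \<bar>Im z\<bar>" by (simp add: n(2) abs_mult)
  also have "\<dots> \<le> norm z" by (rule abs_Im_le_cmod)
  finally show False using assms(1) by simp
qed

lemma expm1_quot_neq_0: "norm z < 2 * pi \<Longrightarrow> expm1_quot z \<noteq> 0"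
  using exp_neq_1_ball[of z] by (auto simp: expm1_quot_def)

text \<open>
  The expansion of \<open>z e\<^sup>a\<^sup>z / (e\<^sup>z - 1)\<close>, with coefficients \<open>B\<^sub>n(a) / n!\<close>.
\<close>

definition bernoulli_gen_fps :: "complex \<Rightarrow> complex fps" where
  "bernoulli_gen_fps a = fps_expansion (\<lambda>z. exp (a * z) / expm1_quot z) 0"

lemma holomorphic_bernoulli_gen:
  "(\<lambda>z. exp (a * z) / expm1_quot z) holomorphic_on eball 0 (ereal (2 * pi))"
  using expm1_quot_neq_0 by (intro holomorphic_intros) (auto simp: dist_norm)

lemma conv_radius_bernoulli_gen_fps: "fps_conv_radius (bernoulli_gen_fps a) \<ge> ereal (2 * pi)"
  unfolding bernoulli_gen_fps_def by (rule conv_radius_fps_expansion[OF holomorphic_bernoulli_gen])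

lemma norm_less_conv_radius_bernoulli:
  "norm z < 2 * pi \<Longrightarrow> ereal (norm (z::complex)) < fps_conv_radius (bernoulli_gen_fps a)"
  using conv_radius_bernoulli_gen_fps[of a] by (meson ereal_less(2) less_ereal.simps(1) order.strict_trans2)

lemma eval_bernoulli_gen_fps:
  "norm z < 2 * pi \<Longrightarrow> eval_fps (bernoulli_gen_fps a) z = exp (a * z) / expm1_quot z"
  unfolding bernoulli_gen_fps_def by (subst eval_fps_expansion'[OF holomorphic_bernoulli_gen]) auto

lemma bernoulli_gen_fps_0 [simp]: "fps_nth (bernoulli_gen_fps a) 0 = 1"
  using eval_bernoulli_gen_fps[of 0 a] by (simp add: eval_fps_at_0 expm1_quot_def)

section \<open>Splitting Mellin integrals and continuing the Hurwitz zeta function\<close>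

lemma lebesgue_on_subset_integrable:
  fixes f :: "real \<Rightarrow> 'a :: {banach, second_countable_topology}"
  assumes "integrable (lebesgue_on S) f" "T \<subseteq> S" "S \<in> sets lebesgue" "T \<in> sets lebesgue"
  shows "integrable (lebesgue_on T) f"
  using set_integrable_subset[of lebesgue S f T] assms
  by (simp add: set_integrable_def integrable_restrict_space)

lemma lebesgue_integral_half_line_split:
  fixes f :: "real \<Rightarrow> complex"
  assumes f: "integrable (lebesgue_on {0<..}) f" and e: "e > 0"
  shows "integral\<^sup>L (lebesgue_on {0<..}) f = integral {0..e} f + integral {e..} f"
proof -
  have "(f has_integral integral {0<..e} f) {0<..e}" "(f has_integral integral {e..} f) {e..}"
    using e by (auto intro!: integrable_integral integrable_on_lebesgue_on lebesgue_on_subset_integrable[OF f])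
  then have "(f has_integral (integral {0<..e} f + integral {e..} f)) ({0<..e} \<union> {e..})"
    by (rule has_integral_Un) (rule negligible_subset[of "{e}"], auto)
  moreover have "{0<..e} \<union> {e..} = {0<..}" using e by auto
  moreover have "integral {0<..e} f = integral {0..e} f"
    by (rule integral_spike_set) (auto intro: negligible_subset[of "{0}"])
  ultimately show ?thesis
    using lebesgue_integral_eq_integral[OF f] by (simp add: integral_unique)
qed

lemma sums_exp_geometric:
  fixes a :: complex
  assumes "x > 0"
  shows "(\<lambda>n. exp (- ((of_nat n + a) * of_real x))) sums (exp (- a * of_real x) / (1 - exp (- of_real x)))"
proof -
  have "(\<lambda>n. exp (- of_real x) ^ n) sums (1 / (1 - exp (- of_real x :: complex)))"
    using assms by (intro geometric_sums) simp
  from sums_mult[OF this, of "exp (- a * of_real x)"] show ?thesis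
    by (simp add: exp_of_nat_mult [symmetric] exp_add [symmetric] algebra_simps)
qed

lemma summable_shifted_powr:
  assumes "\<alpha> > 0" "\<sigma> > 1"
  shows "summable (\<lambda>n. (real n + \<alpha>) powr (- \<sigma>))"
proof (rule summable_comparison_test_bigo)
  show "summable (\<lambda>n. norm (real n powr (- \<sigma>)))"
    using assms by (simp add: summable_real_powr_iff)
  show "(\<lambda>n. (real n + \<alpha>) powr (- \<sigma>)) \<in> O(\<lambda>n. real n powr (- \<sigma>))"
    using assms by real_asymp
qed

text \<open>The part over \<open>x \<ge> 1\<close> of the Mellin integral for \<open>Gamma s\<close>
  times the Hurwitz series. The singularity at \<open>x = 0\<close> is cut off, so it is entire in
  \<open>s\<close>.\<close>

definition hurwitz_tail :: "complex \<Rightarrow> complex \<Rightarrow> complex" where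
  "hurwitz_tail a s = integral\<^sup>L (lebesgue_on {1..})
     (\<lambda>x. of_real x powr (s - 1) * (exp (- a * of_real x) / (1 - exp (- of_real x))))"

lemma holomorphic_hurwitz_tail:
  assumes a: "Re a > 0"
  shows "hurwitz_tail a holomorphic_on UNIV"
  unfolding hurwitz_tail_def [abs_def]
proof (rule holomorphic_on_lebesgue_integral)
  let ?f = "\<lambda>s x. complex_of_real x powr (s - 1) * (exp (- a * of_real x) / (1 - exp (- of_real x)))"
  have nz: "1 - exp (- complex_of_real x) \<noteq> 0" if "x \<ge> 1" for x
  proof
    assume "1 - exp (- complex_of_real x) = 0"
    then have "exp (- x) = 1" by (metis exp_of_real of_real_eq_1_iff of_real_minus right_minus_eq)
    then show False using that by simp
  qed
  show "?f z \<in> borel_measurable (lebesgue_on {1..})" for z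
    by (intro continuous_imp_measurable_on_sets_lebesgue continuous_intros) (use nz in auto)
  show "(\<lambda>z. ?f z x) holomorphic_on UNIV" for x
    by (intro holomorphic_intros)
  show "\<exists>r>0. \<exists>g. cball z0 r \<subseteq> UNIV \<and> integrable (lebesgue_on {1..}) g \<and>
                (\<forall>z\<in>cball z0 r. \<forall>x\<in>space (lebesgue_on {1..}). norm (?f z x) \<le> g x)" for z0
  proof (intro exI conjI ballI)
    \<comment> \<open>The exponent \<open>\<bar>Re z0\<bar> + 1\<close> dominates
      \<open>Re z\<close> on the unit disc about \<open>z0\<close>, which suffices for
      \<open>x \<ge> 1\<close>, and it is positive, so the Gamma kernel is integrable. The
      denominator is smallest at \<open>x = 1\<close>.\<close>
    let ?g = "\<lambda>x. x powr ((\<bar>Re z0\<bar> + 1) - 1) * exp (- Re a * x) / (1 - exp (- 1))"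
    show "integrable (lebesgue_on {1..}) ?g"
      using a by (intro integrable_divide lebesgue_on_subset_integrable[OF integrable_Gamma_kernel_real]) auto
    show "norm (?f z x) \<le> ?g x" if "z \<in> cball z0 1" "x \<in> space (lebesgue_on {1..})" for z x
    proof -
      have x: "x \<ge> 1" using that(2) by simp
      have "Re z \<le> Re z0 + 1"
        using that(1) complex_Re_le_cmod[of "z - z0"] by (simp add: dist_norm norm_minus_commute)
      then have 1: "x powr (Re z - 1) \<le> x powr ((\<bar>Re z0\<bar> + 1) - 1)"
        using x by (intro powr_mono) auto
      have "norm (1 :: complex) - norm (exp (- complex_of_real x)) \<le> norm (1 - exp (- complex_of_real x))"
        by (rule norm_triangle_ineq2)
      moreover have "exp (- x) \<le> exp (- 1)" using x by simp
      ultimately have 2: "1 - exp (- 1) \<le> norm (1 - exp (- complex_of_real x))"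
        by (simp del: exp_le_cancel_iff)
      have "x powr (Re z - 1) * (exp (- Re a * x) / norm (1 - exp (- complex_of_real x))) \<le>
            x powr ((\<bar>Re z0\<bar> + 1) - 1) * (exp (- Re a * x) / (1 - exp (- 1)))"
        using 1 2 by (intro mult_mono frac_le) auto
      then show ?thesis using x by (simp add: norm_mult norm_divide norm_powr_real_powr)
    qed
  qed auto
qed auto

text \<open>On \<open>{0..1}\<close> the integrand is \<open>x powr (s - 2)\<close> times the
  Bernoulli generating function at \<open>-x\<close>, so its integral is the value at
  \<open>-1\<close> of the series with coefficients divided by \<open>s - 1 + n\<close>.\<close>

lemma hurwitz_mellin_split:
  assumes s: "Re s > 1" and a: "Re a > 0"
  shows "Gamma s * (\<Sum>n. 1 / (of_nat n + a) powr s) =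
         eval_fps (euler_fps (s - 1) (bernoulli_gen_fps a)) (- 1) + hurwitz_tail a s"
proof -
  let ?f = "\<lambda>x. complex_of_real x powr (s - 1) * (exp (- a * of_real x) / (1 - exp (- of_real x)))"
  have summ: "summable (\<lambda>n. norm (1::complex) * (of_nat n + Re a) powr (- Re s))"
    using summable_shifted_powr[OF a s] by simp
  have s0: "Re s > 0" using s by simp
  have eq: "complex_of_real x powr (s - 1) * (\<Sum>n. 1 * exp (- ((of_nat n + a) * of_real x))) = ?f x"
    if "x > 0" for x
    using sums_exp_geometric[OF that, of a] by (simp add: sums_iff)
  have int: "integrable (lebesgue_on {0<..}) ?f"
    using mellin_dirichlet_series(1)[OF s0 a summ]
    by (subst (asm) Bochner_Integration.integrable_cong[OF refl eq]) auto
  have "Gamma s * (\<Sum>n. 1 / (of_nat n + a) powr s) = integral\<^sup>L (lebesgue_on {0<..}) ?f"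
    using mellin_dirichlet_series(2)[OF s0 a summ]
    by (subst (asm) Bochner_Integration.integral_cong[OF refl eq]) auto
  also have "\<dots> = integral {0..1} ?f + integral {1..} ?f"
    by (rule lebesgue_integral_half_line_split[OF int]) simp
  also have "integral {1..} ?f = hurwitz_tail a s"
    unfolding hurwitz_tail_def
    by (rule lebesgue_integral_eq_integral [symmetric, OF lebesgue_on_subset_integrable[OF int]]) auto
  also have "integral {0..1} ?f = integral {0..1}
       (\<lambda>x. of_real x powr (s - 1 - 1) * eval_fps (bernoulli_gen_fps a) (- of_real x))"
  proof (rule integral_cong)
    fix x :: real assume x: "x \<in> {0..1}"
    show "?f x = of_real x powr (s - 1 - 1) * eval_fps (bernoulli_gen_fps a) (- of_real x)"
    \<comment> \<open>At \<open>x = 0\<close> both sides are 0, since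
      \<open>0 powr _ = 0\<close>.\<close>
    proof (cases "x = 0")
      case False
      have "norm (- complex_of_real x) < 2 * pi" using x pi_gt3 by simp
      then have "eval_fps (bernoulli_gen_fps a) (- of_real x) =
          exp (a * - of_real x) / ((exp (- of_real x) - 1) / - of_real x)"
        using False by (subst eval_bernoulli_gen_fps) (simp_all add: expm1_quot_def)
      also have "\<dots> = of_real x * (exp (- a * of_real x) / (1 - exp (- of_real x)))"
        using False by (cases "exp (- complex_of_real x) = 1") (simp_all add: field_simps)
      finally show ?thesis using False by (simp add: powr_diff power2_eq_square)
    qed simp
  qed
  also have "\<dots> = of_real 1 powr (s - 1) * eval_fps (euler_fps (s - 1) (bernoulli_gen_fps a)) (- of_real 1)"
    using norm_less_conv_radius_bernoulli[of 1 a] pi_gt3 s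
    by (intro integral_unique has_integral_mellin_fps) auto
  finally show ?thesis by simp
qed

text \<open>
  The Mellin integral of \<open>e\<^sup>-\<^sup>a\<^sup>x / (1 - e\<^sup>-\<^sup>x)\<close> split at \<open>x = 1\<close> and divided by \<open>\<Gamma>(s)\<close>. The terms
  \<open>1 / (\<Gamma>(s) (s + m))\<close> are written as \<open>s (s + 1) \<cdots> (s + m - 1) / \<Gamma>(s + m + 1)\<close>, which is entire.
\<close>

definition hurwitz_cont :: "complex \<Rightarrow> complex \<Rightarrow> complex" where
  "hurwitz_cont a s = rGamma s / (s - 1) +
     (\<Sum>m. fps_nth (bernoulli_gen_fps a) (Suc m) * (- 1) ^ Suc m * (pochhammer s m * rGamma (s + of_nat (Suc m))))
     + rGamma s * hurwitz_tail a s"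

text \<open>The functional equation of \<open>rGamma\<close>, iterated, with the last factor
  \<open>s + m\<close> kept apart: it is the factor whose division produced the terms of
  \<open>hurwitz_cont\<close>.\<close>

lemma pochhammer_mult_rGamma:
  "(s + of_nat m) * (pochhammer s m * rGamma (s + of_nat (Suc m))) = rGamma (s::complex)"
  using pochhammer_rGamma[of s "Suc m"] by (simp add: pochhammer_Suc mult_ac)

lemma hurwitz_cont_eq:
  assumes s: "Re s > 1" and a: "Re a > 0"
  shows "hurwitz_cont a s = (\<Sum>n. 1 / (of_nat n + a) powr s)"
proof -
  let ?F = "bernoulli_gen_fps a"
  have r: "ereal (norm (- 1 :: complex)) < fps_conv_radius (euler_fps (s - 1) ?F)"
    using pi_gt3 by (intro order.strict_trans2[OF norm_less_conv_radius_bernoulli fps_conv_radius_euler_fps]) auto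
  have nz: "s + of_nat m \<noteq> 0" for m using s by (auto simp: complex_eq_iff)
  have Gs: "Gamma s * rGamma s = 1"
  proof -
    have "s \<notin> \<int>\<^sub>\<le>\<^sub>0" using s by (auto elim!: nonpos_Ints_cases)
    then show ?thesis by (simp add: rGamma_inverse_Gamma Gamma_eq_zero_iff)
  qed
  have "(\<lambda>n. fps_nth (euler_fps (s - 1) ?F) n * (- 1) ^ n) sums eval_fps (euler_fps (s - 1) ?F) (- 1)"
    by (rule sums_eval_fps[OF r])
  \<comment> \<open>The constant coefficient of the generating function is 1; its term
    \<open>1 / (s - 1)\<close> carries the pole and is split off.\<close>
  then have "(\<lambda>m. fps_nth (euler_fps (s - 1) ?F) (Suc m) * (- 1) ^ Suc m) sums
      (eval_fps (euler_fps (s - 1) ?F) (- 1) - 1 / (s - 1))"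
    by (subst sums_Suc_iff) (simp add: euler_fps_def)
  from sums_mult[OF this, of "rGamma s"]
  have "(\<lambda>m. fps_nth ?F (Suc m) * (- 1) ^ Suc m * (pochhammer s m * rGamma (s + of_nat (Suc m)))) sums
      (rGamma s * (eval_fps (euler_fps (s - 1) ?F) (- 1) - 1 / (s - 1)))"
  proof (rule sums_cong [THEN iffD1, rotated])
    fix m
    show "rGamma s * (fps_nth (euler_fps (s - 1) ?F) (Suc m) * (- 1) ^ Suc m) =
      fps_nth ?F (Suc m) * (- 1) ^ Suc m * (pochhammer s m * rGamma (s + of_nat (Suc m)))"
      using nz[of m] pochhammer_mult_rGamma[of s m, symmetric] by (simp add: euler_fps_def field_simps)
  qed
  then have "hurwitz_cont a s = rGamma s * (eval_fps (euler_fps (s - 1) ?F) (- 1) + hurwitz_tail a s)"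
    by (simp add: hurwitz_cont_def sums_iff algebra_simps)
  also have "\<dots> = rGamma s * (Gamma s * (\<Sum>n. 1 / (of_nat n + a) powr s))"
    by (simp add: hurwitz_mellin_split[OF s a])
  finally show ?thesis using Gs by (simp add: mult_ac flip: mult.assoc)
qed

text \<open>For large \<open>m\<close> the factor \<open>s + m\<close> has norm at least 1 on the
  disc, so \<open>pochhammer_mult_rGamma\<close> bounds the terms by the Taylor coefficients times
  the maximum of \<open>rGamma\<close>. The coefficients are absolutely summable because the radius
  \<open>2 * pi\<close> exceeds 1.\<close>

lemma holomorphic_hurwitz_cont:
  assumes a: "Re a > 0"
  shows "hurwitz_cont a holomorphic_on - {1}"
proof -
  let ?F = "bernoulli_gen_fps a"
  let ?t = "\<lambda>m s. fps_nth ?F (Suc m) * (- 1) ^ Suc m * (pochhammer s m * rGamma (s + of_nat (Suc m)))"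
  have "(\<lambda>s. \<Sum>m. ?t m s) holomorphic_on UNIV"
  proof (rule holomorphic_uniform_sequence)
    show "(\<lambda>s. \<Sum>m<n. ?t m s) holomorphic_on UNIV" for n
      by (intro holomorphic_intros)
    fix x :: complex
    have "compact (rGamma ` cball x 1 :: complex set)"
      by (intro compact_continuous_image holomorphic_on_imp_continuous_on holomorphic_rGamma compact_cball)
    then obtain B where B: "\<And>s. s \<in> cball x 1 \<Longrightarrow> norm (rGamma s) \<le> B"
      using compact_imp_bounded bounded_iff by (metis imageI)
    have "uniform_limit (cball x 1) (\<lambda>n s. \<Sum>m<n. ?t m s) (\<lambda>s. \<Sum>m. ?t m s) sequentially"
    proof (rule Weierstrass_m_test_ev)
      have "summable (\<lambda>m. norm (fps_nth ?F m * 1 ^ m))"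
        using pi_gt3 by (intro norm_summable_fps norm_less_conv_radius_bernoulli) auto
      then show "summable (\<lambda>m. norm (fps_nth ?F (Suc m)) * B)"
        by (intro summable_mult2) (subst summable_Suc_iff, simp)
      show "\<forall>\<^sub>F m in sequentially. \<forall>s\<in>cball x 1. norm (?t m s) \<le> norm (fps_nth ?F (Suc m)) * B"
        using eventually_ge_at_top[of "nat \<lceil>norm x + 2\<rceil>"]
      proof eventually_elim
        case (elim m)
        show ?case
        proof
          fix s assume s: "s \<in> cball x 1"
          have "norm s \<le> norm x + norm (x - s)" by (metis norm_triangle_sub norm_minus_commute)
          then have "norm s \<le> norm x + 1" using s by (simp add: dist_norm)
          then have "1 \<le> norm (of_nat m :: complex) - norm s" using elim by simp linarith
          also have "\<dots> \<le> norm (s + of_nat m)" by (metis add.commute norm_diff_ineq)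
          finally have 1: "1 \<le> norm (s + of_nat m)" .
          have "1 * norm (pochhammer s m * rGamma (s + of_nat (Suc m))) \<le>
                norm (s + of_nat m) * norm (pochhammer s m * rGamma (s + of_nat (Suc m)))"
            using 1 by (rule mult_right_mono) simp
          also have "\<dots> = norm (rGamma s)"
            by (simp only: pochhammer_mult_rGamma norm_mult [symmetric])
          also have "\<dots> \<le> B" using B s by blast
          finally have "norm (pochhammer s m * rGamma (s + of_nat (Suc m))) \<le> B" by simp
          then show "norm (?t m s) \<le> norm (fps_nth ?F (Suc m)) * B"
            unfolding norm_mult[of "fps_nth ?F (Suc m) * (- 1) ^ Suc m"]
            by (intro mult_mono) (auto simp: norm_mult norm_power)
        qed
      qed
    qed
    then show "\<exists>d>0. cball x d \<subseteq> UNIV \<and> uniform_limit (cball x d) (\<lambda>n s. \<Sum>m<n. ?t m s) (\<lambda>s. \<Sum>m. ?t m s) sequentially"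
      by (intro exI[of _ 1]) auto
  qed auto
  then have "(\<lambda>s. \<Sum>m. ?t m s) holomorphic_on - {1}" by (rule holomorphic_on_subset) auto
  moreover have "hurwitz_tail a holomorphic_on - {1}"
    using holomorphic_hurwitz_tail[OF a] by (rule holomorphic_on_subset) auto
  ultimately show ?thesis
    unfolding hurwitz_cont_def [abs_def] by (intro holomorphic_intros) auto
qed

text \<open>Resolves the definite description: the plane without the point 1 is connected, so the
  identity theorem determines the continuation from the half plane of convergence.\<close>

lemma hurwitz_zeta_eq_cont:
  assumes a: "Re a > 0" and s: "s \<noteq> 1"
  shows "hurwitz_zeta s a = hurwitz_cont a s"
  unfolding hurwitz_zeta_def
proof (rule the_equality)
  show "\<exists>f. f holomorphic_on - {1} \<and> (\<forall>u. 1 < Re u \<longrightarrow> f u = (\<Sum>n. 1 / (of_nat n + a) powr u)) \<and>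
            hurwitz_cont a s = f s"
    using holomorphic_hurwitz_cont[OF a] hurwitz_cont_eq[OF _ a] by blast
  fix w assume "\<exists>f. f holomorphic_on - {1} \<and> (\<forall>u. 1 < Re u \<longrightarrow> f u = (\<Sum>n. 1 / (of_nat n + a) powr u)) \<and> w = f s"
  then obtain f where f: "f holomorphic_on - {1}" "\<And>u. 1 < Re u \<Longrightarrow> f u = (\<Sum>n. 1 / (of_nat n + a) powr u)" "w = f s"
    by blast
  have "f s = hurwitz_cont a s"
  proof (rule analytic_continuation_open[where s = "{u. Re u > 1}" and s' = "- {1}"
        and f = f and g = "hurwitz_cont a" and z = s])
    show "{u. Re u > 1} \<noteq> {}" by (auto intro!: exI[of _ 2])
    show "connected (- {1 :: complex})" by (rule connected_punctured_universe) simp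
    show "f u = hurwitz_cont a u" if "u \<in> {u. Re u > 1}" for u
      using that f(2)[of u] hurwitz_cont_eq[OF _ a] by simp
  qed (use f(1) holomorphic_hurwitz_cont[OF a] s in \<open>auto simp: open_halfspace_Re_gt\<close>)
  then show "w = hurwitz_cont a s" using f(3) by simp
qed

text \<open>The classical value \<open>- B_(m+1)(a) / (m + 1)\<close>. The zero of
  \<open>rGamma\<close> at \<open>-m\<close> removes the pole term, the tail and every summand
  except the one with index \<open>m\<close>, where \<open>s + m = 0\<close>.\<close>

lemma hurwitz_zeta_neg_of_nat:
  assumes a: "Re a > 0"
  shows "hurwitz_zeta (- of_nat m) a = - fact m * fps_nth (bernoulli_gen_fps a) (Suc m)"
proof -
  let ?F = "bernoulli_gen_fps a"
  let ?s = "- of_nat m :: complex"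
  let ?t = "\<lambda>j. fps_nth ?F (Suc j) * (- 1) ^ Suc j * (pochhammer ?s j * rGamma (?s + of_nat (Suc j)))"
  have rG: "rGamma ?s = 0" by (simp add: rGamma_eq_zero_iff)
  have 0: "?t j = 0" if "j \<noteq> m" for j
  proof -
    have "?s + of_nat j \<noteq> 0" using that by (simp add: add_eq_0_iff2)
    then show ?thesis using pochhammer_mult_rGamma[of ?s j] rG by auto
  qed
  have "?s \<noteq> 1"
  proof
    assume "?s = 1"
    then have "Re ?s = Re 1" by (rule arg_cong)
    then show False by simp
  qed
  then have "hurwitz_zeta ?s a = hurwitz_cont a ?s" by (rule hurwitz_zeta_eq_cont[OF a])
  also have "\<dots> = (\<Sum>j. ?t j)" by (simp add: hurwitz_cont_def rG)
  also have "\<dots> = (\<Sum>j\<in>{m}. ?t j)" by (rule suminf_finite) (use 0 in auto)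
  also have "\<dots> = - fact m * fps_nth ?F (Suc m)"
    by (simp add: pochhammer_same)
  finally show ?thesis .
qed

section \<open>The Mellin transform of the bracket\<close>

text \<open>The Lerch series in \<open>x\<close> for exponent 1. Obtaining it from the geometric
  series by \<open>euler_fps\<close> provides its differential equation and its radius of
  convergence.\<close>

definition lerch_fps :: "complex \<Rightarrow> complex fps" where
  "lerch_fps a = euler_fps a (Abs_fps (\<lambda>_. 1))"

lemma conv_radius_geometric: "fps_conv_radius (Abs_fps (\<lambda>_. 1 :: complex)) \<ge> 1"
  unfolding fps_conv_radius_def one_ereal_def
proof (rule conv_radius_geI_ex')
  fix r :: real assume "0 < r" "ereal r < ereal 1"
  then show "summable (\<lambda>n. fps_nth (Abs_fps (\<lambda>_. 1 :: complex)) n * of_real r ^ n)"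
    by (simp add: summable_geometric)
qed

lemma norm_less_conv_radius_geometric:
  "norm (q::complex) < 1 \<Longrightarrow> ereal (norm q) < fps_conv_radius (Abs_fps (\<lambda>_. 1 :: complex))"
  using conv_radius_geometric by (metis ereal_less(3) order.strict_trans2)

lemma sums_lerch_fps:
  assumes "norm q < 1"
  shows "(\<lambda>k. q ^ k / (of_nat k + a)) sums eval_fps (lerch_fps a) q"
  using sums_eval_fps[OF order.strict_trans2[OF norm_less_conv_radius_geometric[OF assms]
      fps_conv_radius_euler_fps[of _ a]]]
  by (simp add: lerch_fps_def euler_fps_def add.commute)

lemma lerch_fps_ode:
  assumes "norm q < 1" "Re a > 0"
  shows "a * eval_fps (lerch_fps a) q + q * eval_fps (fps_deriv (lerch_fps a)) q = 1 / (1 - q)"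
proof -
  have "a + of_nat n \<noteq> 0" for n using assms(2) by (auto simp: complex_eq_iff)
  moreover have "eval_fps (Abs_fps (\<lambda>_. 1)) q = 1 / (1 - q)"
    using geometric_sums[OF assms(1)] by (simp add: eval_fps_def sums_iff)
  ultimately show ?thesis
    unfolding lerch_fps_def using eval_euler_fps_ode[of a q] norm_less_conv_radius_geometric[OF assms(1)] by simp
qed

lemma lerch_phi_1_eq:
  assumes "norm q < 1" "Re a > 0"
  shows "lerch_phi q 1 a = eval_fps (lerch_fps a) q"
proof -
  have "of_nat k + a \<noteq> 0" for k using assms(2) by (auto simp: complex_eq_iff)
  then show ?thesis
    using assms(1) sums_lerch_fps[OF assms(1), of a] by (simp add: lerch_phi_def lerch_series_def sums_iff)
qed

lemma summable_norm_lerch: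
  fixes q a :: complex
  assumes "norm q < 1"
  shows "summable (\<lambda>k. norm (q ^ k / (of_nat k + a)))"
  using norm_summable_fps[OF order.strict_trans2[OF norm_less_conv_radius_geometric[OF assms]
      fps_conv_radius_euler_fps[of _ a]]]
  by (simp add: euler_fps_def add.commute)

text \<open>Multiplication by the geometric series turns coefficients into their partial sums, and
  the \<open>shifted_harm n a\<close> are the partial sums of \<open>1 / (k + a)\<close>.\<close>

lemma sums_shifted_harm:
  assumes "norm q < 1"
  shows "(\<lambda>n. shifted_harm n a * q ^ n) sums (eval_fps (lerch_fps a) q / (1 - q))"
proof -
  have "(\<lambda>n. \<Sum>i\<le>n. q ^ i / (of_nat i + a) * q ^ (n - i)) sums
      ((\<Sum>k. q ^ k / (of_nat k + a)) * (\<Sum>k. q ^ k))"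
    using assms by (intro Cauchy_product_sums summable_norm_lerch) (simp_all add: norm_power summable_geometric)
  also have "(\<lambda>n. \<Sum>i\<le>n. q ^ i / (of_nat i + a) * q ^ (n - i)) = (\<lambda>n. shifted_harm n a * q ^ n)"
    by (auto simp: fun_eq_iff shifted_harm_def sum_distrib_right power_add [symmetric] intro!: sum.cong)
  finally show ?thesis
    using sums_lerch_fps[OF assms, of a] suminf_geometric[OF assms] by (simp add: sums_iff)
qed

text \<open>\<open>mellin_dirichlet_series\<close> with coefficients
  \<open>shifted_harm n a\<close>, whose logarithmic growth ensures summability for
  \<open>Re s > 1\<close>; the inner sum is their generating function at
  \<open>exp (- x)\<close>.\<close>

lemma harm_zeta_mellin:
  assumes s: "Re s > 1" and a: "Re a > 0"
  defines "f \<equiv> \<lambda>x. complex_of_real x powr (s - 1) *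
      (exp (- of_real x * a) * lerch_phi (exp (- of_real x)) 1 a / (1 - exp (- of_real x)))"
  shows "integrable (lebesgue_on {0<..}) f"
    and "integral\<^sup>L (lebesgue_on {0<..}) f = Gamma s * harm_zeta s a"
proof -
  have "a \<notin> \<int>\<^sub>\<le>\<^sub>0" using a by (auto elim!: nonpos_Ints_cases)
  then obtain \<delta> r where \<delta>: "\<delta> > 0" "r > 0" "\<And>b n. b \<in> cball a r \<Longrightarrow> \<delta> * (real n + 1) \<le> norm (of_nat n + b)"
    using nonpos_Ints_lower_bound by metis
  have s0: "Re s > 0" using s by simp
  have summ: "summable (\<lambda>n. norm (shifted_harm n a) * (of_nat n + Re a) powr (- Re s))"
  proof (rule summable_comparison_test_bigo)
    show "summable (\<lambda>n. norm ((1 + ln (real n + 1)) * (real n + 1) powr (- Re s)))"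
      using summable_log_powr[OF s] by (simp add: abs_mult)
    have "(\<lambda>n. norm (shifted_harm n a)) \<in> O(\<lambda>n. 1 + ln (real n + 1))"
      using norm_shifted_harm_le[OF \<delta>(1) \<delta>(3)] \<delta>(2) by (intro bigoI[of _ "1 / \<delta>"]) auto
    moreover have "(\<lambda>n. (real n + Re a) powr (- Re s)) \<in> O(\<lambda>n. (real n + 1) powr (- Re s))"
      using s a by real_asymp
    ultimately show "(\<lambda>n. norm (shifted_harm n a) * (of_nat n + Re a) powr (- Re s)) \<in>
        O(\<lambda>n. (1 + ln (real n + 1)) * (real n + 1) powr (- Re s))"
      by (rule landau_o.big.mult)
  qed
  have eq: "complex_of_real x powr (s - 1) * (\<Sum>n. shifted_harm n a * exp (- ((of_nat n + a) * of_real x))) = f x"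
    if x: "x > 0" for x
  proof -
    have q: "norm (exp (- complex_of_real x)) < 1" using x by simp
    have "(\<lambda>n. exp (- of_real x * a) * (shifted_harm n a * exp (- of_real x) ^ n)) sums
        (exp (- of_real x * a) * (eval_fps (lerch_fps a) (exp (- of_real x)) / (1 - exp (- of_real x))))"
      by (intro sums_mult sums_shifted_harm q)
    also have "(\<lambda>n. exp (- of_real x * a) * (shifted_harm n a * exp (- of_real x) ^ n)) =
        (\<lambda>n. shifted_harm n a * exp (- ((of_nat n + a) * of_real x)))"
      by (simp add: fun_eq_iff exp_of_nat_mult [symmetric] exp_add [symmetric] algebra_simps)
    finally show ?thesis by (simp add: f_def lerch_phi_1_eq[OF q a] sums_iff)
  qed
  show "integrable (lebesgue_on {0<..}) f"
    using mellin_dirichlet_series(1)[OF s0 a summ]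
    by (subst (asm) Bochner_Integration.integrable_cong[OF refl eq]) auto
  show "integral\<^sup>L (lebesgue_on {0<..}) f = Gamma s * harm_zeta s a"
    using mellin_dirichlet_series(2)[OF s0 a summ] unfolding harm_zeta_def
    by (subst (asm) Bochner_Integration.integral_cong[OF refl eq]) auto
qed

text \<open>The Mercator series. It identifies the logarithm in the bracket with minus the Lerch
  term for \<open>a = 1\<close>.\<close>

lemma lerch_fps_1_eq_Ln:
  assumes "norm q < 1"
  shows "q * eval_fps (lerch_fps 1) q = - Ln (1 - q)"
proof -
  have "(\<lambda>n. q ^ Suc n / of_nat (Suc n)) sums (q * eval_fps (lerch_fps 1) q)"
    using sums_mult[OF sums_lerch_fps[OF assms, of 1], of q] by (simp add: add.commute)
  moreover have "(\<lambda>n. q ^ n / of_nat n) sums (- Ln (1 - q))"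
    using sums_minus[OF Ln_series'[of "- q"]] assms by simp
  then have "(\<lambda>n. q ^ Suc n / of_nat (Suc n)) sums (- Ln (1 - q))"
    by (subst sums_Suc_iff) simp
  ultimately show ?thesis by (rule sums_unique2)
qed

lemma harm_zeta_diff_mellin:
  assumes s: "Re s > 1" and a: "Re a > 0"
  defines "f \<equiv> \<lambda>x. complex_of_real x powr (s - 1) * (bracket_ray a (- of_real x) / (1 - exp (- of_real x)))"
  shows "integrable (lebesgue_on {0<..}) f"
    and "integral\<^sup>L (lebesgue_on {0<..}) f = Gamma s * (harm_zeta s a - harm_zeta s 1)"
proof -
  let ?g = "\<lambda>a x. complex_of_real x powr (s - 1) *
      (exp (- of_real x * a) * lerch_phi (exp (- of_real x)) 1 a / (1 - exp (- of_real x)))"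
  have 1: "Re 1 > 0" by simp
  have eq: "?g a x - ?g 1 x = f x" if "x > 0" for x
  proof -
    have "norm (exp (- complex_of_real x)) < 1" using that by simp
    from lerch_fps_1_eq_Ln[OF this] lerch_phi_1_eq[OF this 1]
    show ?thesis by (simp add: f_def bracket_ray_def diff_divide_distrib add_divide_distrib algebra_simps)
  qed
  have "integrable (lebesgue_on {0<..}) (\<lambda>x. ?g a x - ?g 1 x)"
    by (intro Bochner_Integration.integrable_diff harm_zeta_mellin s a 1)
  then show "integrable (lebesgue_on {0<..}) f"
    by (subst (asm) Bochner_Integration.integrable_cong[OF refl eq]) auto
  have "integral\<^sup>L (lebesgue_on {0<..}) (\<lambda>x. ?g a x - ?g 1 x) = Gamma s * (harm_zeta s a - harm_zeta s 1)"
    using harm_zeta_mellin[OF s a] harm_zeta_mellin[OF s 1] by (simp add: right_diff_distrib)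
  then show "integral\<^sup>L (lebesgue_on {0<..}) f = Gamma s * (harm_zeta s a - harm_zeta s 1)"
    by (subst (asm) Bochner_Integration.integral_cong[OF refl eq]) auto
qed

text \<open>By \<open>lerch_fps_ode\<close> at \<open>exp z\<close>, the product
  \<open>exp (z * a) * Phi\<close> has derivative \<open>exp (a * z) / (1 - exp z)\<close>; the
  logarithm contributes \<open>- exp z / (1 - exp z)\<close>.\<close>

lemma has_field_derivative_bracket_ray:
  assumes a: "Re a > 0" and z: "Re z < 0"
  shows "(bracket_ray a has_field_derivative (exp (a * z) - exp z) / (1 - exp z)) (at z)"
proof -
  have q: "norm (exp z) < 1" if "Re z < 0" for z :: complex using that by simp
  have r: "norm (exp z) < fps_conv_radius (Abs_fps (\<lambda>_. 1 :: complex))"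
    using q[OF z] by (rule norm_less_conv_radius_geometric)
  have "Re (exp z) < 1" using q[OF z] complex_Re_le_cmod[of "exp z"] by linarith
  then have nn: "1 - exp z \<notin> \<real>\<^sub>\<le>\<^sub>0" and nz: "1 - exp z \<noteq> 0"
    by (auto simp: complex_nonpos_Reals_iff)
  let ?S = "eval_fps (lerch_fps a)" and ?S' = "eval_fps (fps_deriv (lerch_fps a))"
  have d1: "((\<lambda>z. ?S (exp z)) has_field_derivative ?S' (exp z) * exp z) (at z)"
    unfolding lerch_fps_def
    by (rule DERIV_chain2[where f = "eval_fps (euler_fps a (Abs_fps (\<lambda>_. 1)))" and g = exp,
          OF has_field_derivative_euler_fps[OF r] DERIV_exp])
  have d2: "((\<lambda>z. exp (z * a)) has_field_derivative exp (z * a) * a) (at z)"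
    by (auto intro!: derivative_eq_intros)
  have d3: "((\<lambda>z. Ln (1 - exp z)) has_field_derivative inverse (1 - exp z) * (0 - exp z)) (at z)"
    by (rule DERIV_chain2[where f = Ln and g = "\<lambda>z. 1 - exp z", OF has_field_derivative_Ln[OF nn]])
       (auto intro!: derivative_eq_intros)
  have "((\<lambda>z. exp (z * a) * ?S (exp z) + Ln (1 - exp z)) has_field_derivative
      exp (z * a) * (a * ?S (exp z) + exp z * ?S' (exp z)) - exp z / (1 - exp z)) (at z)"
    by (rule DERIV_cong[OF DERIV_add[OF DERIV_mult[OF d2 d1] d3]]) (simp add: algebra_simps divide_inverse)
  also have "exp (z * a) * (a * ?S (exp z) + exp z * ?S' (exp z)) - exp z / (1 - exp z) =
      (exp (a * z) - exp z) / (1 - exp z)"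
    by (subst lerch_fps_ode[OF q[OF z] a]) (simp add: diff_divide_distrib mult.commute)
  finally have "((\<lambda>z. exp (z * a) * ?S (exp z) + Ln (1 - exp z)) has_field_derivative
      (exp (a * z) - exp z) / (1 - exp z)) (at z)" .
  then show ?thesis
  proof (rule has_field_derivative_transform_within_open[where S = "{z. Re z < 0}"])
    show "exp (y * a) * ?S (exp y) + Ln (1 - exp y) = bracket_ray a y" if "y \<in> {z. Re z < 0}" for y
      using that lerch_phi_1_eq[OF q[of y] a] by (simp add: bracket_ray_def)
  qed (use z in \<open>auto simp: open_halfspace_Re_lt\<close>)
qed

section \<open>The bracket near the origin\<close>

text \<open>Existence comes from a holomorphic logarithm of the zero-free function
  \<open>expm1_quot\<close> on the disc. Uniqueness and the derivative both come from
  differentiating \<open>exp (L u) = (exp u - 1) / u\<close>, which determines \<open>L'\<close> off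
  0.\<close>

lemma log_expm1_quot_props:
  shows "log_expm1_quot holomorphic_on ball 0 (2 * pi)" and "log_expm1_quot 0 = 0"
    and "\<And>z. z \<in> ball 0 (2 * pi) - {0} \<Longrightarrow>
      (log_expm1_quot has_field_derivative exp z / (exp z - 1) - 1 / z) (at z)"
proof -
  define B where "B = ball (0::complex) (2 * pi)"
  define spec where "spec = (\<lambda>L. L holomorphic_on B \<and> L 0 = 0 \<and> (\<forall>u \<in> B - {0}. exp (L u) = (exp u - 1) / u))"
  have B: "open B" "connected B" "convex B" "0 \<in> B" by (auto simp: B_def)
  have nz: "exp u \<noteq> 1" if "u \<in> B - {0}" for u
    using that exp_neq_1_ball[of u] by (auto simp: B_def)
  have deriv: "(L has_field_derivative exp u / (exp u - 1) - 1 / u) (at u)"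
    if L: "spec L" and u: "u \<in> B - {0}" for L u
  proof -
    have "(L has_field_derivative deriv L u) (at u)"
      using L u B(1) by (auto simp: spec_def intro: holomorphic_derivI)
    then have 1: "((\<lambda>u. exp (L u)) has_field_derivative exp (L u) * deriv L u) (at u)"
      by (intro DERIV_chain2[where f = exp and g = L] DERIV_exp)
    have "((\<lambda>u. (exp u - 1) / u) has_field_derivative (exp u * u - (exp u - 1) * 1) / (u * u)) (at u)"
      using u by (intro DERIV_divide) (auto intro!: derivative_eq_intros)
    then have 2: "((\<lambda>u. exp (L u)) has_field_derivative (exp u * u - (exp u - 1) * 1) / (u * u)) (at u)"
    proof (rule has_field_derivative_transform_within_open[where S = "B - {0}"])
      show "(exp y - 1) / y = exp (L y)" if "y \<in> B - {0}" for y
        using L that by (simp add: spec_def)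
    qed (use B u in auto)
    have "exp (L u) = (exp u - 1) / u" using L u by (simp add: spec_def)
    with DERIV_unique[OF 1 2] have "(exp u - 1) / u * deriv L u = (exp u * u - (exp u - 1)) / (u * u)" by simp
    moreover have "deriv L u = (exp u - 1) / u * deriv L u * (u / (exp u - 1))"
      using nz[OF u] u by simp
    ultimately have "deriv L u = (exp u * u - (exp u - 1)) / (u * u) * (u / (exp u - 1))" by metis
    also have "\<dots> = exp u / (exp u - 1) - 1 / u"
      using nz[OF u] u by (simp add: field_simps)
    finally have "deriv L u = exp u / (exp u - 1) - 1 / u" .
    then show ?thesis using \<open>(L has_field_derivative deriv L u) (at u)\<close> by simp
  qed
  obtain g where g: "g holomorphic_on B" "\<And>z. z \<in> B \<Longrightarrow> expm1_quot z = exp (g z)"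
    using contractible_imp_holomorphic_log[of expm1_quot B] holomorphic_expm1_quot
      convex_imp_contractible[OF B(3)] expm1_quot_neq_0 by (auto simp: B_def)
  define L where "L = (\<lambda>z. g z - g 0)"
  have "exp (g 0) = 1" using g(2)[of 0] B(4) by (simp add: expm1_quot_def)
  then have L: "spec L"
  proof -
    have "exp (g u) = (exp u - 1) / u" if "u \<in> B - {0}" for u
      using g(2)[of u] that by (simp add: expm1_quot_def)
    then show ?thesis
      unfolding spec_def L_def using g(1) \<open>exp (g 0) = 1\<close> by (auto simp: exp_diff intro!: holomorphic_intros)
  qed
  have unique: "L' z = L z" if L': "spec L'" and z: "z \<in> B" for L' z
  proof -
    have "(\<lambda>z. L' z - L z) constant_on B"
    proof (rule has_field_derivative_0_imp_constant_on)
      show "((\<lambda>z. L' z - L z) has_field_derivative 0) (at u)" if u: "u \<in> B" for u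
      proof -
        have hol: "(\<lambda>z. L' z - L z) holomorphic_on B"
          using L L' by (auto simp: spec_def intro!: holomorphic_intros)
        have dh: "deriv (\<lambda>z. L' z - L z) holomorphic_on B" using hol B(1) by (rule holomorphic_deriv)
        \<comment> \<open>The derivatives are compared only away from 0; the identity theorem
          carries the vanishing over to 0.\<close>
        have "deriv (\<lambda>z. L' z - L z) u = 0"
        proof (rule analytic_continuation_open[where s = "B - {0}" and s' = B and g = "\<lambda>_. 0"
              and f = "deriv (\<lambda>z. L' z - L z)"])
          show "deriv (\<lambda>z. L' z - L z) z = 0" if "z \<in> B - {0}" for z
            using DERIV_diff[OF deriv[OF L' that] deriv[OF L that]] by (simp add: DERIV_imp_deriv)
          have "1 \<in> B - {0}" using pi_gt3 by (simp add: B_def)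
          then show "B - {0} \<noteq> {}" by blast
        qed (use B u dh in auto)
        then show ?thesis using holomorphic_derivI[OF hol B(1) u] by simp
      qed
    qed (use B in auto)
    then obtain c where "\<And>z. z \<in> B \<Longrightarrow> L' z - L z = c" by (auto simp: constant_on_def)
    from this[OF z] this[OF B(4)] L L' show ?thesis by (simp add: spec_def)
  qed
  have eq: "log_expm1_quot z = L z" if "z \<in> B" for z
    unfolding log_expm1_quot_def
  proof (rule the_equality)
    show "\<exists>L'. L' holomorphic_on ball 0 (2 * pi) \<and> L' 0 = 0 \<and>
        (\<forall>u \<in> ball 0 (2 * pi) - {0}. exp (L' u) = (exp u - 1) / u) \<and> L z = L' z"
      using L unfolding spec_def B_def by blast
    show "w = L z" if "\<exists>L'. L' holomorphic_on ball 0 (2 * pi) \<and> L' 0 = 0 \<and>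
        (\<forall>u \<in> ball 0 (2 * pi) - {0}. exp (L' u) = (exp u - 1) / u) \<and> w = L' z" for w
      using that unique[OF _ \<open>z \<in> B\<close>] unfolding spec_def B_def by blast
  qed
  show "log_expm1_quot holomorphic_on ball 0 (2 * pi)"
    using L eq by (auto simp: spec_def B_def intro: holomorphic_transform)
  show "log_expm1_quot 0 = 0" using eq[OF B(4)] L by (simp add: spec_def)
  show "(log_expm1_quot has_field_derivative exp z / (exp z - 1) - 1 / z) (at z)"
    if "z \<in> ball 0 (2 * pi) - {0}" for z
    using deriv[OF L, of z]
    by (rule has_field_derivative_transform_within_open[where S = B]) (use that B eq in \<open>auto simp: B_def\<close>)
qed

text \<open>The zeta values turn the series into minus the termwise primitive of
  \<open>(F z - 1) / z\<close>, where \<open>F\<close> is the Bernoulli generating function;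
  \<open>euler_fps 1\<close> divides by \<open>n + 1\<close> and so performs this
  integration.\<close>

lemma bracket_circle_eq:
  assumes a: "Re a > 0" and z: "norm z < 2 * pi"
  shows "bracket_circle a z = - z * eval_fps (euler_fps 1 (fps_shift 1 (bernoulli_gen_fps a))) z
           + Digamma 1 - Digamma a + log_expm1_quot z"
proof -
  let ?F = "bernoulli_gen_fps a"
  have "(\<lambda>n. fps_nth (euler_fps 1 (fps_shift 1 ?F)) n * z ^ n) sums eval_fps (euler_fps 1 (fps_shift 1 ?F)) z"
    using norm_less_conv_radius_bernoulli[OF z, of a]
    by (intro sums_eval_fps order.strict_trans2[OF _ fps_conv_radius_euler_fps]) simp
  from sums_mult[OF this, of "- z"]
  have "(\<lambda>n. - fps_nth ?F (Suc n) / of_nat (Suc n) * z ^ Suc n) sums (- z * eval_fps (euler_fps 1 (fps_shift 1 ?F)) z)"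
    by (simp add: euler_fps_def mult_ac)
  also have "(\<lambda>n. - fps_nth ?F (Suc n) / of_nat (Suc n) * z ^ Suc n) =
     (\<lambda>n. hurwitz_zeta (1 - of_nat (Suc n)) a / fact (Suc n) * z ^ Suc n)"
  proof
    fix n
    have "hurwitz_zeta (1 - of_nat (Suc n)) a = - fact n * fps_nth ?F (Suc n)"
      using hurwitz_zeta_neg_of_nat[OF a, of n] by simp
    then show "- fps_nth ?F (Suc n) / of_nat (Suc n) * z ^ Suc n =
        hurwitz_zeta (1 - of_nat (Suc n)) a / fact (Suc n) * z ^ Suc n"
      by (simp only: fact_Suc of_nat_mult) (simp del: of_nat_Suc)
  qed
  finally show ?thesis by (simp add: bracket_circle_def sums_iff)
qed

lemma bracket_circle_0: "Re a > 0 \<Longrightarrow> bracket_circle a 0 = Digamma 1 - Digamma a"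
  by (subst bracket_circle_eq) (simp_all add: log_expm1_quot_props)

lemma holomorphic_bracket_circle:
  assumes a: "Re a > 0"
  shows "bracket_circle a holomorphic_on ball 0 (2 * pi)"
proof -
  let ?P = "euler_fps 1 (fps_shift 1 (bernoulli_gen_fps a))"
  have "ball (0::complex) (2 * pi) \<subseteq> eball 0 (fps_conv_radius ?P)"
  proof
    fix z :: complex assume "z \<in> ball 0 (2 * pi)"
    then have "ereal (norm z) < fps_conv_radius (fps_shift 1 (bernoulli_gen_fps a))"
      using norm_less_conv_radius_bernoulli[of z a] by simp
    then have "ereal (norm z) < fps_conv_radius ?P"
      using fps_conv_radius_euler_fps by (rule order.strict_trans2)
    then show "z \<in> eball 0 (fps_conv_radius ?P)" by simp
  qed
  then have "(\<lambda>z. - z * eval_fps ?P z + Digamma 1 - Digamma a + log_expm1_quot z) holomorphic_on ball 0 (2 * pi)"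
    by (intro holomorphic_intros log_expm1_quot_props)
  then show ?thesis
    by (rule holomorphic_transform) (simp add: bracket_circle_eq[OF a])
qed

text \<open>The series contributes \<open>- (exp (a * z) / (exp z - 1) - 1 / z)\<close> and the
  logarithm \<open>exp z / (exp z - 1) - 1 / z\<close>; the poles \<open>1 / z\<close>
  cancel.\<close>

lemma has_field_derivative_bracket_circle:
  assumes a: "Re a > 0" and z: "z \<in> ball 0 (2 * pi) - {0}"
  shows "(bracket_circle a has_field_derivative (exp (a * z) - exp z) / (1 - exp z)) (at z)"
proof -
  let ?F = "bernoulli_gen_fps a"
  let ?G = "fps_shift 1 ?F"
  let ?P = "euler_fps 1 ?G"
  have z': "norm z < 2 * pi" "z \<noteq> 0" using z by auto
  have r: "ereal (norm z) < fps_conv_radius ?G" using norm_less_conv_radius_bernoulli[OF z'(1), of a] by simp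
  have nz: "exp z \<noteq> 1" using exp_neq_1_ball[OF z'] .
  have G: "eval_fps ?P z + z * eval_fps (fps_deriv ?P) z = eval_fps ?G z"
    using eval_euler_fps_ode[of 1 z ?G] r of_nat_neq_0 by (metis mult_1 of_nat_Suc)
  have "(\<lambda>n. fps_nth ?F n * z ^ n) sums eval_fps ?F z"
    by (intro sums_eval_fps norm_less_conv_radius_bernoulli z')
  then have "(\<lambda>n. fps_nth ?F (Suc n) * z ^ Suc n) sums (eval_fps ?F z - 1)"
    by (subst sums_Suc_iff) simp
  moreover have "(\<lambda>n. fps_nth ?F (Suc n) * z ^ Suc n) sums (z * eval_fps ?G z)"
    using sums_mult[OF sums_eval_fps[OF r], of z] by (simp add: mult_ac)
  ultimately have "z * eval_fps ?G z = eval_fps ?F z - 1" by (rule sums_unique2[symmetric])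
  then have "eval_fps ?G z = (z * exp (a * z) / (exp z - 1) - 1) / z"
    using z' by (simp add: eval_bernoulli_gen_fps expm1_quot_def field_simps)
  then have G': "eval_fps ?G z = exp (a * z) / (exp z - 1) - 1 / z"
    using z' by (simp add: diff_divide_distrib)
  have d1: "((\<lambda>z. - z) has_field_derivative -1) (at z)" by (auto intro!: derivative_eq_intros)
  have "((\<lambda>z. (- z * eval_fps ?P z + (Digamma 1 - Digamma a)) + log_expm1_quot z) has_field_derivative
     ((- 1) * eval_fps ?P z + eval_fps (fps_deriv ?P) z * (- z) + 0) + (exp z / (exp z - 1) - 1 / z)) (at z)"
    by (intro DERIV_add DERIV_mult d1 has_field_derivative_euler_fps r DERIV_const log_expm1_quot_props z)
  also have "((- 1) * eval_fps ?P z + eval_fps (fps_deriv ?P) z * (- z) + 0) + (exp z / (exp z - 1) - 1 / z) =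
     - eval_fps ?G z + (exp z / (exp z - 1) - 1 / z)"
    by (subst G [symmetric]) (simp add: algebra_simps)
  also have "\<dots> = - ((exp (a * z) - exp z) / (exp z - 1))"
    by (simp only: G' diff_divide_distrib) simp
  also have "\<dots> = (exp (a * z) - exp z) / (1 - exp z)"
    by (metis minus_diff_eq minus_divide_right)
  finally show ?thesis
    by (rule has_field_derivative_transform_within_open[where S = "ball 0 (2 * pi)"])
       (use z bracket_circle_eq[OF a] in auto)
qed

text \<open>With \<open>q = exp (- x)\<close>, the bracket is \<open>exp (- x * a)\<close> times the
  difference of the Lerch series for \<open>a\<close> and for 1, plus
  \<open>(exp (- x * a) - q) * (- Ln (1 - q) / q)\<close>. The first part converges by Tannery's
  theorem, as the coefficients \<open>t k\<close> are of order \<open>1 / k^2\<close>; the second is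
  of order \<open>x * ln x\<close> and vanishes in the limit.\<close>

lemma bracket_ray_limit:
  assumes a: "Re a > 0"
  shows "((\<lambda>x. bracket_ray a (- of_real x)) \<longlongrightarrow> Digamma 1 - Digamma a) (at_right 0)"
proof -
  define q where "q = (\<lambda>x::real. exp (- complex_of_real x))"
  define t where "t = (\<lambda>k::nat. 1 / (of_nat k + a) - 1 / (of_nat k + 1))"
  have an: "a \<notin> \<int>\<^sub>\<le>\<^sub>0" using a by (auto elim!: nonpos_Ints_cases)
  then have nz: "of_nat k + a \<noteq> 0" for k by (rule of_nat_add_neq_0)
  obtain \<delta> r where \<delta>: "\<delta> > 0" "r > 0" "\<And>b n. b \<in> cball a r \<Longrightarrow> \<delta> * (real n + 1) \<le> norm (of_nat n + b)"
    using nonpos_Ints_lower_bound[OF an] by metis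
  have q1: "norm (q x) < 1" if "x > 0" for x using that by (simp add: q_def)
  have "summable (\<lambda>k. norm (1 - a) / \<delta> * (real k + 1) powr (- 2))"
    by (intro summable_mult summable_shifted_powr) auto
  moreover have tb: "norm (t k) \<le> norm (1 - a) / \<delta> * (real k + 1) powr (- 2)" for k
  proof -
    have "t k = (1 - a) / ((of_nat k + a) * (of_nat k + 1))"
      using nz[of k] of_nat_neq_0[of k, where 'a = complex] by (simp add: t_def field_simps)
    also have "norm \<dots> = norm (1 - a) / (norm (of_nat k + a) * (real k + 1))"
      by (simp add: norm_divide norm_mult) (metis norm_of_nat of_nat_Suc add.commute)
    also have "\<dots> \<le> norm (1 - a) / ((\<delta> * (real k + 1)) * (real k + 1))"
    proof (rule divide_left_mono)
      show "\<delta> * (real k + 1) * (real k + 1) \<le> norm (of_nat k + a) * (real k + 1)"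
        using \<delta>(2,3) by (intro mult_right_mono) auto
      show "0 < norm (of_nat k + a) * (real k + 1) * (\<delta> * (real k + 1) * (real k + 1))"
        using nz[of k] \<delta>(1) by (intro mult_pos_pos) auto
    qed auto
    also have "\<dots> = norm (1 - a) / \<delta> * (real k + 1) powr (- 2)"
      by (simp add: powr_minus power2_eq_square field_simps)
    finally show ?thesis .
  qed
  ultimately have M: "summable (\<lambda>k. norm (1 - a) / \<delta> * (real k + 1) powr (- 2))"
    "\<And>k. norm (t k) \<le> norm (1 - a) / \<delta> * (real k + 1) powr (- 2)" by blast+
  have pos: "\<forall>\<^sub>F x in at_right 0. x > (0::real)" by (rule eventually_at_right_less)
  have lim1: "((\<lambda>x. \<Sum>k. q x ^ k * t k) \<longlongrightarrow> (\<Sum>k. t k)) (at_right 0)"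
  proof (rule tannerys_theorem[THEN conjunct2, THEN conjunct2])
    have "((\<lambda>x. q x ^ k * t k) \<longlongrightarrow> q 0 ^ k * t k) (at_right 0)" for k
      unfolding q_def by (intro tendsto_intros)
    then show "((\<lambda>x. q x ^ k * t k) \<longlongrightarrow> t k) (at_right 0)" for k by (simp add: q_def)
    have "\<forall>\<^sub>F x in at_right 0. \<forall>k. norm (q x ^ k * t k) \<le> norm (1 - a) / \<delta> * (real k + 1) powr (- 2)"
      using pos
    proof eventually_elim
      case (elim x)
      show ?case
      proof
        fix k
        have "norm (q x ^ k * t k) \<le> 1 * norm (t k)"
          unfolding norm_mult norm_power using q1[OF elim] by (intro mult_right_mono power_le_one) auto
        then show "norm (q x ^ k * t k) \<le> norm (1 - a) / \<delta> * (real k + 1) powr (- 2)" using M(2)[of k] by linarith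
      qed
    qed
    then show "\<forall>\<^sub>F (k, x) in sequentially \<times>\<^sub>F at_right 0. norm (q x ^ k * t k) \<le> norm (1 - a) / \<delta> * (real k + 1) powr (- 2)"
      using eventually_prodI[OF always_eventually[of "\<lambda>_. True"]]
      by (fastforce simp: case_prod_unfold elim: eventually_mono)
  qed (use M in auto)
  \<comment> \<open>The series for \<open>Digamma\<close>; the Euler-Mascheroni constant cancels in
    the difference of the cases \<open>z = 1\<close> and \<open>z = a\<close>.\<close>
  have "(\<lambda>n. inverse (of_nat (Suc n)) - inverse (z + of_nat n)) sums (Digamma z + euler_mascheroni)"
    if "z \<noteq> 0" for z :: complex
    using summable_Digamma[OF that] by (simp add: Digamma_def summable_sums)
  from sums_diff[OF this[of 1] this[of a]] nz[of 0]
  have "t sums (Digamma 1 - Digamma a)"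
    by (simp add: t_def [abs_def] inverse_eq_divide add.commute)
  then have t: "(\<Sum>k. t k) = Digamma 1 - Digamma a" by (simp add: sums_iff)
  have lim2: "((\<lambda>x. (exp (- of_real x * a) - q x) * (- Ln (1 - q x) / q x)) \<longlongrightarrow> 0) (at_right 0)"
  proof -
    have "((\<lambda>z. exp (- z * a) - exp (- z)) has_field_derivative (1 - a)) (at 0)"
      by (auto intro!: derivative_eq_intros)
    then have "((\<lambda>z. (exp (- z * a) - exp (- z)) / z) \<longlongrightarrow> 1 - a) (at 0)"
      by (simp add: has_field_derivative_iff)
    moreover have "filterlim complex_of_real (at 0) (at_right 0)"
      unfolding filterlim_at by (auto intro!: tendsto_eq_intros eventually_at_right_less eventually_mono[OF pos])
    ultimately have 1: "((\<lambda>x. (exp (- of_real x * a) - q x) / of_real x) \<longlongrightarrow> 1 - a) (at_right 0)"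
      unfolding q_def by (rule filterlim_compose[where g = "\<lambda>z. (exp (- z * a) - exp (- z)) / z"])
    have "((\<lambda>x::real. x * (- ln (1 - exp (- x)) / exp (- x))) \<longlongrightarrow> 0) (at_right 0)"
      by real_asymp
    then have 2: "((\<lambda>x. complex_of_real (x * (- ln (1 - exp (- x)) / exp (- x)))) \<longlongrightarrow> of_real 0) (at_right 0)"
      by (rule tendsto_of_real)
    from tendsto_mult[OF 1 2] have "((\<lambda>x. (exp (- of_real x * a) - q x) / of_real x *
        complex_of_real (x * (- ln (1 - exp (- x)) / exp (- x)))) \<longlongrightarrow> 0) (at_right 0)" by simp
    moreover have "\<forall>\<^sub>F x in at_right 0. (exp (- of_real x * a) - q x) / of_real x *
        complex_of_real (x * (- ln (1 - exp (- x)) / exp (- x))) = (exp (- of_real x * a) - q x) * (- Ln (1 - q x) / q x)"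
      using pos
    proof eventually_elim
      case (elim x)
      have "q x = of_real (exp (- x))" by (simp add: q_def exp_of_real [symmetric])
      moreover have "Ln (1 - of_real (exp (- x))) = of_real (ln (1 - exp (- x)))"
        using Ln_of_real[of "1 - exp (- x)"] elim by simp
      ultimately show ?case using elim by simp
    qed
    ultimately show ?thesis by (rule Lim_transform_eventually)
  qed
  have eq: "exp (- of_real x * a) * (\<Sum>k. q x ^ k * t k) + (exp (- of_real x * a) - q x) * (- Ln (1 - q x) / q x) =
      bracket_ray a (- of_real x)" if x: "x > 0" for x
  proof -
    have "(\<lambda>k. q x ^ k / (of_nat k + a) - q x ^ k / (of_nat k + 1)) sums
       (eval_fps (lerch_fps a) (q x) - eval_fps (lerch_fps 1) (q x))"
      by (intro sums_diff sums_lerch_fps q1 x)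
    then have "(\<Sum>k. q x ^ k * t k) = eval_fps (lerch_fps a) (q x) - eval_fps (lerch_fps 1) (q x)"
      by (simp add: sums_iff t_def right_diff_distrib)
    moreover have "q x \<noteq> 0" by (simp add: q_def)
    then have "eval_fps (lerch_fps 1) (q x) = - Ln (1 - q x) / q x"
      using lerch_fps_1_eq_Ln[OF q1[OF x]] by (simp add: field_simps)
    ultimately have "exp (- of_real x * a) * (\<Sum>k. q x ^ k * t k) + (exp (- of_real x * a) - q x) * (- Ln (1 - q x) / q x) =
       exp (- of_real x * a) * eval_fps (lerch_fps a) (q x) + q x * (Ln (1 - q x) / q x)"
      by (simp add: algebra_simps)
    also have "\<dots> = bracket_ray a (- of_real x)"
      using \<open>q x \<noteq> 0\<close> lerch_phi_1_eq[OF q1[OF x] a] by (simp add: bracket_ray_def q_def)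
    finally show ?thesis .
  qed
  have "((\<lambda>x. exp (- of_real x * a) * (\<Sum>k. q x ^ k * t k) + (exp (- of_real x * a) - q x) * (- Ln (1 - q x) / q x))
      \<longlongrightarrow> exp (- of_real 0 * a) * (\<Sum>k. t k) + 0) (at_right 0)"
    by (intro tendsto_add tendsto_mult lim1 lim2 tendsto_intros)
  then have "((\<lambda>x. exp (- of_real x * a) * (\<Sum>k. q x ^ k * t k) + (exp (- of_real x * a) - q x) * (- Ln (1 - q x) / q x))
      \<longlongrightarrow> Digamma 1 - Digamma a) (at_right 0)" by (simp add: t)
  then show ?thesis
    by (rule Lim_transform_eventually) (use pos in eventually_elim, rule eq)
qed

text \<open>On the left half of the disc, which is convex, both brackets have the same derivative,
  so they differ by a constant. Their common limit at 0 along the negative axis makes it 0.\<close>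

lemma bracket_ray_eq_circle:
  assumes a: "Re a > 0" and x: "0 < x" "x < 2 * pi"
  shows "bracket_ray a (- of_real x) = bracket_circle a (- of_real x)"
proof -
  define S where "S = {z. Re z < 0} \<inter> ball 0 (2 * pi)"
  have "\<exists>c. \<forall>z\<in>S. bracket_ray a z - bracket_circle a z = c"
  proof (rule has_field_derivative_zero_constant)
    show "convex S" unfolding S_def by (intro convex_Int convex_halfspace_Re_lt convex_ball)
    show "((\<lambda>z. bracket_ray a z - bracket_circle a z) has_field_derivative 0) (at z within S)" if "z \<in> S" for z
    proof -
      have z: "Re z < 0" "z \<in> ball 0 (2 * pi) - {0}" using that by (auto simp: S_def)
      show ?thesis
        using DERIV_diff[OF has_field_derivative_bracket_ray[OF a z(1)] has_field_derivative_bracket_circle[OF a z(2)]]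
        by (simp add: has_field_derivative_at_within)
    qed
  qed
  then obtain c where c: "\<And>z. z \<in> S \<Longrightarrow> bracket_ray a z - bracket_circle a z = c" by blast
  have inS: "- complex_of_real x \<in> S" if "0 < x" "x < 2 * pi" for x using that by (simp add: S_def)
  have "isCont (bracket_circle a) 0"
    using holomorphic_on_imp_continuous_on[OF holomorphic_bracket_circle[OF a]]
    by (simp add: continuous_on_eq_continuous_at)
  moreover have "((\<lambda>x. - complex_of_real x) \<longlongrightarrow> 0) (at_right 0)" by (auto intro!: tendsto_eq_intros)
  ultimately have "((\<lambda>x. bracket_circle a (- of_real x)) \<longlongrightarrow> bracket_circle a 0) (at_right 0)"
    by (rule isCont_tendsto_compose)
  from tendsto_diff[OF bracket_ray_limit[OF a] this]
  have "((\<lambda>x. bracket_ray a (- of_real x) - bracket_circle a (- of_real x)) \<longlongrightarrow> 0) (at_right 0)"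
    by (simp add: bracket_circle_0[OF a])
  moreover have "\<forall>\<^sub>F x in at_right 0. 0 < x \<and> x < 2 * pi"
    by (intro eventually_conj eventually_at_right_less eventually_at_right_field[THEN iffD2] exI[of _ "2 * pi"]) auto
  then have "\<forall>\<^sub>F x in at_right 0. bracket_ray a (- of_real x) - bracket_circle a (- of_real x) = c"
    by eventually_elim (use c inS in blast)
  ultimately have "((\<lambda>x::real. c) \<longlongrightarrow> 0) (at_right 0)" by (rule Lim_transform_eventually)
  then have "c = 0" by (simp add: tendsto_const_iff)
  then show ?thesis using c[OF inS[OF x]] by simp
qed

section \<open>The Hankel integral\<close>

text \<open>The boundary values at \<open>- \<epsilon>\<close> of one primitive give both the circle
  and the missing piece \<open>{0..\<epsilon>}\<close> of the Mellin integral, so the circle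
  completes the two rays and the dependence on \<open>\<epsilon>\<close> disappears.\<close>

lemma hankel_contour_I_eq:
  assumes a: "Re a > 0" and s: "Re s > 1" and \<epsilon>: "0 < \<epsilon>" "\<epsilon> < 2 * pi"
  shows "hankel_contour_I \<epsilon> s a =
           sin (of_real pi * s) / of_real pi * Gamma s * (harm_zeta s a - harm_zeta s 1)"
proof -
  \<comment> \<open>Since \<open>1 - exp z = - z * expm1_quot z\<close>, the bracket divided by
    \<open>1 - exp z\<close> is \<open>K z / z\<close>, and \<open>K\<close> is holomorphic on the
    disc.\<close>
  define K where "K = (\<lambda>z. - bracket_circle a z / expm1_quot z)"
  have holK: "K holomorphic_on eball 0 (ereal (2 * pi))"
    unfolding K_def using holomorphic_bracket_circle[OF a] expm1_quot_neq_0
    by (intro holomorphic_intros) auto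
  define F where "F = fps_expansion K 0"
  have radF: "ereal (norm z) < fps_conv_radius F" if "norm z < 2 * pi" for z :: complex
    using conv_radius_fps_expansion[OF holK] that unfolding F_def
    by (meson less_ereal.simps(1) order.strict_trans2)
  have evalF: "eval_fps F z = K z" if "norm z < 2 * pi" for z
    unfolding F_def using that by (subst eval_fps_expansion'[OF holK]) auto
  define P where "P = eval_fps (euler_fps (s - 1) F)"
  define E where "E = (\<lambda>\<theta>::real. exp ((s - 1) * (\<i> * of_real \<theta>)))"
  define f where "f = (\<lambda>x. complex_of_real x powr (s - 1) * (bracket_ray a (- of_real x) / (1 - exp (- of_real x))))"
  define R where "R = integral {\<epsilon>..} f"
  have rcis: "rcis r \<theta> = exp (of_real (ln r) + \<i> * of_real \<theta>)" if "r > 0" for r \<theta>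
    using that by (simp add: rcis_def cis_conv_exp exp_add exp_of_real)
  have rcis_pi: "rcis x pi = - of_real x" "rcis x (- pi) = - of_real x" for x
    by (simp_all add: rcis_def cis_conv_exp exp_minus)
  \<comment> \<open>The minus sign comes from dividing \<open>K z\<close> by
    \<open>z = - x\<close>.\<close>
  have origin: "integral {0..\<epsilon>} f = - (of_real \<epsilon> powr (s - 1) * P (- of_real \<epsilon>))"
  proof -
    have "((\<lambda>x. of_real x powr (s - 1 - 1) * eval_fps F (- of_real x)) has_integral
             of_real \<epsilon> powr (s - 1) * eval_fps (euler_fps (s - 1) F) (- of_real \<epsilon>)) {0..\<epsilon>}"
      using s \<epsilon> radF[of "of_real \<epsilon>"] by (intro has_integral_mellin_fps) auto
    then have "((\<lambda>x. - (of_real x powr (s - 1 - 1) * eval_fps F (- of_real x))) has_integral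
             - (of_real \<epsilon> powr (s - 1) * P (- of_real \<epsilon>))) {0..\<epsilon>}"
      unfolding P_def by (rule has_integral_neg)
    moreover have "- (of_real x powr (s - 1 - 1) * eval_fps F (- of_real x)) = f x" if x: "x \<in> {0..\<epsilon>}" for x
    proof (cases "x = 0")
      case False
      with x have x': "x > 0" "x < 2 * pi" using \<epsilon> by auto
      have "1 - exp (- complex_of_real x) \<noteq> 0"
        using exp_neq_1_ball[of "- of_real x"] x' by simp
      then show ?thesis
        using x' evalF[of "- of_real x"] bracket_ray_eq_circle[OF a x']
        by (simp add: f_def K_def expm1_quot_def powr_diff field_simps power2_eq_square)
    qed (simp add: f_def)
    ultimately have "(f has_integral - (of_real \<epsilon> powr (s - 1) * P (- of_real \<epsilon>))) {0..\<epsilon>}"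
      by (rule has_integral_eq[rotated])
    then show ?thesis by (rule integral_unique)
  qed
  \<comment> \<open>On either side of the axis, \<open>z powr (s - 1)\<close> contributes the phase
    \<open>E \<theta>\<close> and \<open>dz/dx\<close> the factor \<open>-1\<close>.\<close>
  have ray: "hankel_integrand (bracket_ray a) s x \<theta> * cis \<theta> = - E \<theta> * f x"
    if x: "x > 0" and \<theta>: "\<theta> = pi \<or> \<theta> = - pi" for x \<theta>
  proof -
    have "cis \<theta> = -1" "rcis x \<theta> = - of_real x" using \<theta> rcis_pi by (auto simp: cis_conv_exp exp_minus)
    moreover have "exp ((s - 1) * (of_real (ln x) + \<i> * of_real \<theta>)) = of_real x powr (s - 1) * E \<theta>"
      using x by (simp add: E_def powr_def Ln_of_real exp_add [symmetric] distrib_left)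
    ultimately show ?thesis by (simp add: hankel_integrand_def f_def)
  qed
  have rays: "integral {\<epsilon>..} (\<lambda>x. hankel_integrand (bracket_ray a) s x \<theta> * cis \<theta>) = - E \<theta> * R"
    if "\<theta> = pi \<or> \<theta> = - pi" for \<theta>
  proof -
    have "integral {\<epsilon>..} (\<lambda>x. hankel_integrand (bracket_ray a) s x \<theta> * cis \<theta>) = integral {\<epsilon>..} (\<lambda>x. - E \<theta> * f x)"
      using that \<epsilon> by (intro integral_cong ray) auto
    then show ?thesis by (simp add: R_def)
  qed
  have circle: "integral {- pi..pi} (\<lambda>\<theta>. hankel_integrand (bracket_circle a) s \<epsilon> \<theta> * (\<i> * of_real \<epsilon> * cis \<theta>)) =
      (E pi - E (- pi)) * (of_real \<epsilon> powr (s - 1) * P (- of_real \<epsilon>))"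
  proof -
    \<comment> \<open>The logarithm of \<open>z\<close> with argument \<open>\<theta>\<close>,
      extended to complex \<open>\<theta>\<close> so that the complex chain rule applies;
      \<open>G\<close> is the primitive \<open>z powr (s - 1) * P z\<close> on this branch.\<close>
    define w where "w = (\<lambda>\<theta>::complex. complex_of_real (ln \<epsilon>) + \<i> * \<theta>)"
    define G where "G = (\<lambda>\<theta>. exp ((s - 1) * w \<theta>) * P (exp (w \<theta>)))"
    have "((\<lambda>\<theta>. hankel_integrand (bracket_circle a) s \<epsilon> \<theta> * (\<i> * of_real \<epsilon> * cis \<theta>)) has_integral
        (G (of_real pi) - G (of_real (- pi)))) {- pi..pi}"
    proof (rule fundamental_theorem_of_calculus)
      fix \<theta> :: real
      let ?w = "w (of_real \<theta>)"
      let ?z = "exp ?w"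
      have z: "?z = rcis \<epsilon> \<theta>" using \<epsilon> by (simp add: w_def rcis)
      then have nz: "norm ?z < 2 * pi" "?z \<noteq> 0" using \<epsilon> by auto
      have c: "s - 1 + of_nat n \<noteq> 0" for n
      proof
        assume "s - 1 + of_nat n = 0"
        then have "Re (s - 1 + of_nat n) = 0" by simp
        then show False using s by simp
      qed
      have dw: "(w has_field_derivative \<i>) (at u)" for u
        unfolding w_def by (auto intro!: derivative_eq_intros)
      have d1: "((\<lambda>\<theta>. exp ((s - 1) * w \<theta>)) has_field_derivative exp ((s - 1) * ?w) * ((s - 1) * \<i>)) (at (of_real \<theta>))"
        by (rule DERIV_chain2[where f = exp and g = "\<lambda>\<theta>. (s - 1) * w \<theta>", OF DERIV_exp DERIV_cmult[OF dw]])
      have d2: "((\<lambda>\<theta>. exp (w \<theta>)) has_field_derivative ?z * \<i>) (at (of_real \<theta>))"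
        by (rule DERIV_chain2[where f = exp and g = w, OF DERIV_exp dw])
      have d3: "((\<lambda>\<theta>. P (exp (w \<theta>))) has_field_derivative
          eval_fps (fps_deriv (euler_fps (s - 1) F)) ?z * (?z * \<i>)) (at (of_real \<theta>))"
        unfolding P_def
        by (rule DERIV_chain2[where f = "eval_fps (euler_fps (s - 1) F)" and g = "\<lambda>\<theta>. exp (w \<theta>)",
            OF has_field_derivative_euler_fps[OF radF[OF nz(1)]] d2])
      have "(G has_field_derivative \<i> * exp ((s - 1) * ?w) *
          ((s - 1) * P ?z + ?z * eval_fps (fps_deriv (euler_fps (s - 1) F)) ?z)) (at (of_real \<theta>))"
        unfolding G_def by (rule DERIV_cong[OF DERIV_mult[OF d1 d3]]) (simp add: algebra_simps)
      also have "(s - 1) * P ?z + ?z * eval_fps (fps_deriv (euler_fps (s - 1) F)) ?z = K ?z"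
        unfolding P_def using eval_euler_fps_ode[OF c radF[OF nz(1)]] evalF[OF nz(1)] by simp
      also have "\<i> * exp ((s - 1) * ?w) * K ?z =
          hankel_integrand (bracket_circle a) s \<epsilon> \<theta> * (\<i> * of_real \<epsilon> * cis \<theta>)"
      proof -
        have "K ?z = bracket_circle a ?z * ?z / (1 - exp ?z)"
          using nz exp_neq_1_ball[OF nz] by (simp add: K_def expm1_quot_def field_simps)
        moreover have "of_real \<epsilon> * cis \<theta> = ?z" by (simp add: z rcis_def)
        ultimately show ?thesis
          by (simp add: hankel_integrand_def z [symmetric] w_def mult_ac)
      qed
      finally show "((\<lambda>\<theta>. G (of_real \<theta>)) has_vector_derivative
          hankel_integrand (bracket_circle a) s \<epsilon> \<theta> * (\<i> * of_real \<epsilon> * cis \<theta>)) (at \<theta> within {- pi..pi})"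
        using has_vector_derivative_real_field has_vector_derivative_at_within by blast
    qed auto
    then have int: "integral {- pi..pi} (\<lambda>\<theta>. hankel_integrand (bracket_circle a) s \<epsilon> \<theta> * (\<i> * of_real \<epsilon> * cis \<theta>)) =
        G (of_real pi) - G (of_real (- pi))" by (rule integral_unique)
    \<comment> \<open>Both ends of the circle are the point \<open>- \<epsilon>\<close>, where
      \<open>P\<close> is single-valued; only the phase of the power differs.\<close>
    have G: "G (of_real \<theta>) = E \<theta> * (of_real \<epsilon> powr (s - 1) * P (- of_real \<epsilon>))"
      if "\<theta> = pi \<or> \<theta> = - pi" for \<theta>
    proof -
      have "exp (w (of_real \<theta>)) = - of_real \<epsilon>"
        using that rcis[OF \<epsilon>(1), of \<theta>] rcis_pi by (auto simp: w_def)
      moreover have "exp ((s - 1) * w (of_real \<theta>)) = E \<theta> * of_real \<epsilon> powr (s - 1)"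
        using \<epsilon> by (simp add: w_def E_def powr_def Ln_of_real exp_add [symmetric] algebra_simps)
      ultimately show ?thesis by (simp add: G_def)
    qed
    show ?thesis
      unfolding int G[OF disjI1[OF refl]] G[OF disjI2[OF refl]] by (simp only: left_diff_distrib)
  qed

  have "Gamma s * (harm_zeta s a - harm_zeta s 1) = integral {0..\<epsilon>} f + R"
    using harm_zeta_diff_mellin[OF s a] lebesgue_integral_half_line_split[OF _ \<epsilon>(1), of f]
    by (simp add: f_def R_def)
  then have total: "Gamma s * (harm_zeta s a - harm_zeta s 1) = R - of_real \<epsilon> powr (s - 1) * P (- of_real \<epsilon>)"
    by (simp add: origin)
  have "E (- pi) - E pi = 2 * \<i> * sin (of_real pi * s)"
  proof -
    have "E (- pi) = - exp (- (\<i> * (of_real pi * s)))" "E pi = - exp (\<i> * (of_real pi * s))"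
      using exp_add[of "- (\<i> * (of_real pi * s))" "\<i> * of_real pi"] exp_add[of "\<i> * (of_real pi * s)" "- (\<i> * of_real pi)"]
      by (simp_all add: E_def algebra_simps exp_minus)
    then show ?thesis by (simp add: sin_exp_eq)
  qed
  \<comment> \<open>The rays contribute \<open>E (- pi) * R - E pi * R\<close> and the circle the
    same phase difference times \<open>- \<epsilon> powr (s - 1) * P (- \<epsilon>)\<close>.\<close>
  moreover have "hankel_contour_I \<epsilon> s a = 1 / (2 * of_real pi * \<i>) *
      ((E (- pi) - E pi) * (R - of_real \<epsilon> powr (s - 1) * P (- of_real \<epsilon>)))"
    unfolding hankel_contour_I_def by (subst rays, simp, subst rays, simp, subst circle) (simp add: algebra_simps)
  ultimately show ?thesis by (simp add: total [symmetric])
qed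

text \<open>
  On the cut, \<open>Ln v = Ln (- v) + \<i> \<pi>\<close> also holds just above \<open>v\<close>, and \<open>Ln (- v)\<close> is continuous there.
\<close>

lemma tendsto_powr_from_above:
  fixes v s :: complex
  assumes "v \<noteq> 0"
  shows "((\<lambda>t. (v + \<i> * of_real t) powr s) \<longlongrightarrow> v powr s) (at_right 0)"
proof (cases "v \<in> \<real>\<^sub>\<le>\<^sub>0")
  case False
  have "((\<lambda>t. (v + \<i> * of_real t) powr s) \<longlongrightarrow> (v + \<i> * of_real 0) powr s) (at_right 0)"
    using False by (intro tendsto_intros) auto
  then show ?thesis by simp
next
  case True
  then have v: "Im v = 0" "Re v < 0" using assms by (auto simp: complex_nonpos_Reals_iff complex_eq_iff)
  have eq: "exp (s * (Ln (- v - \<i> * of_real t) + \<i> * of_real pi)) = (v + \<i> * of_real t) powr s" if "t \<ge> 0" for t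
  proof -
    have "- v - \<i> * of_real t \<noteq> 0" using v by (auto simp: complex_eq_iff)
    moreover have "v + \<i> * of_real t \<noteq> 0" using v by (auto simp: complex_eq_iff)
    ultimately show ?thesis
      using Ln_minus[of "- v - \<i> * of_real t"] v that by (simp add: powr_def add.commute split: if_splits)
  qed
  have "((\<lambda>t. exp (s * (Ln (- v - \<i> * of_real t) + \<i> * of_real pi))) \<longlongrightarrow>
      exp (s * (Ln (- v - \<i> * of_real 0) + \<i> * of_real pi))) (at_right 0)"
    using v by (intro tendsto_intros) (auto simp: complex_nonpos_Reals_iff)
  then have "((\<lambda>t. exp (s * (Ln (- v - \<i> * of_real t) + \<i> * of_real pi))) \<longlongrightarrow> v powr s) (at_right 0)"
    by (subst (asm) eq) auto
  then show ?thesis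
    by (rule Lim_transform_eventually)
       (use eventually_at_right_less[of "0::real"] in eventually_elim, rule eq, simp)
qed

text \<open>For \<open>Re a \<le> 0\<close> the right-hand side, as a function of \<open>a\<close>,
  is the required continuation, with the limit from above supplied by
  \<open>harm_zeta_tendsto\<close>. Any other candidate agrees with it on the connected slit
  plane.\<close>

lemma hankel_I_eq:
  assumes a: "a \<notin> \<int>\<^sub>\<le>\<^sub>0" and s: "Re s > 1" and \<epsilon>: "0 < \<epsilon>" "\<epsilon> < 2 * pi"
  shows "hankel_I \<epsilon> s a = sin (of_real pi * s) / of_real pi * Gamma s * (harm_zeta s a - harm_zeta s 1)"
proof (cases "Re a > 0")
  case True
  then show ?thesis using hankel_contour_I_eq[OF True s \<epsilon>] by (simp add: hankel_I_def)
next
  case False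
  define g where "g = (\<lambda>b. sin (of_real pi * s) / of_real pi * Gamma s * (harm_zeta s b - harm_zeta s 1))"
  have hol: "g holomorphic_on (- \<real>\<^sub>\<le>\<^sub>0)"
    unfolding g_def by (intro holomorphic_intros holomorphic_on_harm_zeta s)
  have g: "g b = hankel_contour_I \<epsilon> s b" if "Re b > 0" for b
    using hankel_contour_I_eq[OF that s \<epsilon>] by (simp add: g_def)
  have "((\<lambda>t. harm_zeta s (a + \<i> * of_real t)) \<longlongrightarrow> harm_zeta s a) (at_right 0)"
  proof (rule harm_zeta_tendsto[OF a s])
    show "((\<lambda>t. a + \<i> * of_real t) \<longlongrightarrow> a) (at_right 0)" by (auto intro!: tendsto_eq_intros)
    show "((\<lambda>t. (of_nat n + (a + \<i> * of_real t)) powr s) \<longlongrightarrow> (of_nat n + a) powr s) (at_right 0)" for n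
      using tendsto_powr_from_above[OF of_nat_add_neq_0[OF a, of n]] by (simp add: add.assoc)
  qed auto
  then have lim: "((\<lambda>t. g (a + \<i> * of_real t)) \<longlongrightarrow> g a) (at_right 0)"
    unfolding g_def by (intro tendsto_intros)
  have "hankel_I \<epsilon> s a = (THE w. \<exists>g. g holomorphic_on (- \<real>\<^sub>\<le>\<^sub>0) \<and>
                       (\<forall>b. Re b > 0 \<longrightarrow> g b = hankel_contour_I \<epsilon> s b) \<and>
                       ((\<lambda>t. g (a + \<i> * of_real t)) \<longlongrightarrow> w) (at_right 0))"
    using False by (simp add: hankel_I_def)
  also have "\<dots> = g a"
  proof (rule the_equality)
    show "\<exists>h. h holomorphic_on (- \<real>\<^sub>\<le>\<^sub>0) \<and> (\<forall>b. Re b > 0 \<longrightarrow> h b = hankel_contour_I \<epsilon> s b) \<and>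
              ((\<lambda>t. h (a + \<i> * of_real t)) \<longlongrightarrow> g a) (at_right 0)"
      using hol g lim by blast
    fix w assume "\<exists>h. h holomorphic_on (- \<real>\<^sub>\<le>\<^sub>0) \<and> (\<forall>b. Re b > 0 \<longrightarrow> h b = hankel_contour_I \<epsilon> s b) \<and>
              ((\<lambda>t. h (a + \<i> * of_real t)) \<longlongrightarrow> w) (at_right 0)"
    then obtain h where h: "h holomorphic_on (- \<real>\<^sub>\<le>\<^sub>0)" "\<And>b. Re b > 0 \<Longrightarrow> h b = hankel_contour_I \<epsilon> s b"
      "((\<lambda>t. h (a + \<i> * of_real t)) \<longlongrightarrow> w) (at_right 0)" by blast
    have eq: "h b = g b" if "b \<in> - \<real>\<^sub>\<le>\<^sub>0" for b
    proof (rule analytic_continuation_open[where s = "{b. Re b > 0}" and s' = "- \<real>\<^sub>\<le>\<^sub>0" and f = h and g = g])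
      show "{b. Re b > 0} \<noteq> {}" by (auto intro!: exI[of _ 1])
      show "open (- \<real>\<^sub>\<le>\<^sub>0 :: complex set)" by (intro open_Compl closed_nonpos_Reals_complex)
      show "connected (- \<real>\<^sub>\<le>\<^sub>0 :: complex set)"
      proof -
        have "\<real>\<^sub>\<le>\<^sub>0 = complex_of_real ` {..0}" by (auto simp: nonpos_Reals_def)
        then show ?thesis by (metis starlike_imp_connected starlike_slotted_complex_plane_left)
      qed
      show "{b. Re b > 0} \<subseteq> - \<real>\<^sub>\<le>\<^sub>0" by (auto simp: complex_nonpos_Reals_iff)
    qed (use h hol g that in \<open>auto simp: open_halfspace_Re_gt\<close>)
    \<comment> \<open>Points just above \<open>a\<close> avoid the cut: for \<open>a\<close> on the
      cut because their imaginary part is \<open>t > 0\<close>, otherwise because the slit plane is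
      open.\<close>
    have "\<forall>\<^sub>F t in at_right 0. a + \<i> * of_real t \<in> - \<real>\<^sub>\<le>\<^sub>0"
    proof (cases "a \<in> \<real>\<^sub>\<le>\<^sub>0")
      case True
      show ?thesis
        using eventually_at_right_less[of "0::real"]
        by eventually_elim (use True in \<open>auto simp: complex_nonpos_Reals_iff\<close>)
    next
      case False
      have "((\<lambda>t. a + \<i> * of_real t) \<longlongrightarrow> a) (at_right 0)" by (auto intro!: tendsto_eq_intros)
      then show ?thesis
        using False by (intro topological_tendstoD open_Compl closed_nonpos_Reals_complex) auto
    qed
    then have "\<forall>\<^sub>F t in at_right 0. g (a + \<i> * of_real t) = h (a + \<i> * of_real t)"
      by eventually_elim (rule eq [symmetric])
    with lim have "((\<lambda>t. h (a + \<i> * of_real t)) \<longlongrightarrow> g a) (at_right 0)" by (rule Lim_transform_eventually)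
    with h(3) show "w = g a" by (intro tendsto_unique) auto
  qed
  finally show ?thesis by (simp add: g_def)
qed

text \<open>The reflection formula cancels the sine, which is non-zero because an integer
  \<open>s\<close> with \<open>Re s > 1\<close> would be a natural number.\<close>

lemma Gamma_mult_hankel_I:
  assumes a: "a \<notin> \<int>\<^sub>\<le>\<^sub>0" and s: "Re s > 1" "s \<notin> \<nat>" and \<epsilon>: "0 < \<epsilon>" "\<epsilon> < 2 * pi"
  shows "Gamma (1 - s) * hankel_I \<epsilon> s a = harm_zeta s a - harm_zeta s 1"
proof -
  have "sin (of_real pi * s) \<noteq> 0"
  proof
    assume "sin (of_real pi * s) = 0"
    then obtain n :: int where "of_real pi * s = of_real (of_int n * pi)"
      by (auto simp: sin_eq_0)
    then have n: "s = of_int n" by simp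
    with s(1) have "n \<ge> 0" by simp
    then have "s = of_nat (nat n)" using n by simp
    with s(2) show False by simp
  qed
  moreover have "Gamma (1 - s) * hankel_I \<epsilon> s a =
      Gamma s * Gamma (1 - s) * (sin (of_real pi * s) / of_real pi) * (harm_zeta s a - harm_zeta s 1)"
    unfolding hankel_I_eq[OF a s(1) \<epsilon>] by (simp only: mult_ac)
  ultimately show ?thesis by (simp add: Gamma_reflection_complex)
qed

text \<open>In HOL \<open>Gamma\<close> takes the value 0 at its poles, so for natural
  \<open>s\<close> the product is expressed by its limit \<open>P\<close> at \<open>s\<close>. The
  bound \<open>\<epsilon> < 2 * pi\<close> keeps the circle inside the disc on which the expansion
  of the bracket is valid.\<close>

theorem theorem7:
  fixes a s :: complex and \<epsilon> :: real
  assumes "a \<notin> \<int>\<^sub>\<le>\<^sub>0" and "Re s > 1" and "0 < \<epsilon>" and "\<epsilon> < 2 * pi"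
  shows "(s \<notin> \<nat> \<longrightarrow> harm_zeta s a = Gamma (1 - s) * hankel_I \<epsilon> s a + harm_zeta s 1) \<and>
         (s \<in> \<nat> \<longrightarrow> (\<exists>P. ((\<lambda>w. Gamma (1 - w) * hankel_I \<epsilon> w a) \<longlongrightarrow> P) (at s) \<and>
                          harm_zeta s a = P + harm_zeta s 1))"
proof (intro conjI impI)
  show "harm_zeta s a = Gamma (1 - s) * hankel_I \<epsilon> s a + harm_zeta s 1" if "s \<notin> \<nat>"
    using Gamma_mult_hankel_I[OF assms(1,2) that assms(3,4)] by simp
next
  assume "s \<in> \<nat>"
  then obtain n where n: "s = of_nat n" by (auto elim: Nats_cases)
  \<comment> \<open>Here the base \<open>n + b\<close> is fixed and only the exponent varies, so the
    powers converge even for \<open>b\<close> on the cut.\<close>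
  have cont: "((\<lambda>w. harm_zeta w b) \<longlongrightarrow> harm_zeta s b) (at s)" if "b \<notin> \<int>\<^sub>\<le>\<^sub>0" for b
    using of_nat_add_neq_0[OF that]
    by (intro harm_zeta_tendsto that assms(2)) (auto intro!: tendsto_intros simp: powr_def)
  have "((\<lambda>w. harm_zeta w a - harm_zeta w 1) \<longlongrightarrow> harm_zeta s a - harm_zeta s 1) (at s)"
    by (intro tendsto_diff cont assms(1)) simp
  moreover have "\<forall>\<^sub>F w in at s. harm_zeta w a - harm_zeta w 1 = Gamma (1 - w) * hankel_I \<epsilon> w a"
  proof -
    \<comment> \<open>The unit disc about the integer \<open>s\<close> contains no other integer, so
      the non-integer case applies at every nearby \<open>w\<close> other than
      \<open>s\<close>.\<close>
    have "\<forall>\<^sub>F w in at s. w \<in> ({w. Re w > 1} \<inter> ball s 1) - {s}"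
      using assms(2) by (intro eventually_at_in_open open_Int open_halfspace_Re_gt open_ball) auto
    then show ?thesis
    proof eventually_elim
      case (elim w)
      have "w \<notin> \<nat>"
      proof
        assume "w \<in> \<nat>"
        then obtain m where m: "w = of_nat m" by (auto elim: Nats_cases)
        have "norm (of_int (int n - int m) :: complex) < 1" using elim by (simp add: n m dist_norm)
        then have "n = m" by (subst (asm) norm_of_int) linarith
        then show False using elim n m by simp
      qed
      then show ?case using elim by (simp add: Gamma_mult_hankel_I[OF assms(1) _ _ assms(3,4)])
    qed
  qed
  ultimately have "((\<lambda>w. Gamma (1 - w) * hankel_I \<epsilon> w a) \<longlongrightarrow> harm_zeta s a - harm_zeta s 1) (at s)"
    by (rule Lim_transform_eventually)
  then show "\<exists>P. ((\<lambda>w. Gamma (1 - w) * hankel_I \<epsilon> w a) \<longlongrightarrow> P) (at s) \<and> harm_zeta s a = P + harm_zeta s 1"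
    by (intro exI[of _ "harm_zeta s a - harm_zeta s 1"]) simp
qed

end
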